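(* Let $X$ and $Y$ be MT-spaces, let $\Gamma$ be a standard commutative group or unitary ring, and let $f,g:X\to Y$ be MT-homotopic maps. Then $f^*=g^*:H^*_{\mathrm{MT}}(Y,\Gamma)\to H^*_{\mathrm{MT}}(X,\Gamma)$.
   Context: An MT-space is a set equipped with a $\sigma$-algebra and a topology (the $\sigma$-algebra need not be the Borel $\sigma$-algebra of the topology). Measure-theoretic terms refer to the $\sigma$-algebra, topological terms to the topology. An MT-map is a measurable continuous map. A product of MT-spaces carries the product topology and the $\sigma$-algebra generated by products of measurable sets. Topological spaces such as $[0,1]$ are MT-spaces with their Borel $\sigma$-algebra. A standard Borel space is a measurable space isomorphic to a Borel subset of a Polish space. For a Polish space $P$ and a standard Borel space $T$, $P\times T$ is an MT-space with the $\sigma$-algebra generated by products of Borel sets and the product of the topology of $P$ with the discrete topology on $T$. $\Gamma$ is a standard commutative group or unitary ring: an abelian group or unitary ring that is also a standard Borel space, such that all operations and the inverse map are measurable. Let $\Delta^n$ be the canonical $n$-simplex. A measurable singular $n$-simplex on $X$ is an MT-map $\sigma:\Delta^n\times T\to X$ with $T$ a standard Borel space. A usual singular $n$-cochain $\omega$ on the topological space $X$ (a $\Gamma$-valued function on continuous maps $\Delta^n\to X$) is measurable if, for every measurable singular $n$-simplex $\sigma:\Delta^n\times T\to X$, the map $T\to\Gamma$, $t\mapsto\omega(\sigma|_{\Delta^n\times\{t\}})$, is measurable. Measurable cochains form a subcomplex $C^*_{\mathrm{MT}}(X,\Gamma)$ of the usual singular cochain complex, with the usual coboundary $\delta$, and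 $H^n_{\mathrm{MT}}(X,\Gamma)=\ker\delta_n/\operatorname{im}\delta_{n-1}$. An MT-map $f:X\to Y$ induces $f^*:C^*_{\mathrm{MT}}(Y,\Gamma)\to C^*_{\mathrm{MT}}(X,\Gamma)$, $f^*(\omega)(\sigma)=\omega(f\circ\sigma)$, and hence a map in cohomology. An MT-homotopy is an MT-map $H:X\times[0,1]\to Y$; the maps $H(-,0)$ and $H(-,1)$ are then called MT-homotopic. *)

theory Defs
  imports "HOL-Analysis.Analysis" "HOL-Homology.Homology"
begin

text \<open>A \<open>measure\<close> serves only as a set with a \<open>\<sigma>\<close>-algebra here: nothing below depends on its
  \<open>emeasure\<close>.\<close>

section \<open>Standard Borel spaces\<close>

definition polish_topology :: "'a topology \<Rightarrow> bool" where
  "polish_topology P \<longleftrightarrow> completely_metrizable_space P \<and> second_countable P"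

definition borel_of :: "'a topology \<Rightarrow> 'a measure" where
  "borel_of P = sigma (topspace P) {U. openin P U}"

definition measurable_iso :: "'a measure \<Rightarrow> 'b measure \<Rightarrow> bool" where
  "measurable_iso M N \<longleftrightarrow>
     (\<exists>\<phi> \<in> M \<rightarrow>\<^sub>M N. \<exists>\<psi> \<in> N \<rightarrow>\<^sub>M M. (\<forall>x\<in>space M. \<psi> (\<phi> x) = x) \<and> (\<forall>y\<in>space N. \<phi> (\<psi> y) = y))"

text \<open>A Polish space has at most the cardinality of the continuum, so nothing is lost by letting its
  points be real numbers; its topology \<open>P\<close> is unrelated to the usual one on the reals
  (see \<open>standard_borelI\<close> below).\<close>

definition standard_borel :: "'a measure \<Rightarrow> bool" where
  "standard_borel M \<longleftrightarrow>
     (\<exists>(P :: real topology) B. polish_topology P \<and> B \<in> sets (borel_of P) \<and>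
        measurable_iso M (restrict_space (borel_of P) B))"

lemma space_borel_of [simp]: "space (borel_of P) = topspace P"
  unfolding borel_of_def
proof (rule space_measure_of, rule subsetI)
  show "U \<in> Pow (topspace P)" if "U \<in> {U. openin P U}" for U
    using that by (simp add: openin_subset)
qed

lemma borel_of_continuous_map:
  assumes "continuous_map P Q h"
  shows "h \<in> borel_of P \<rightarrow>\<^sub>M borel_of Q"
  unfolding borel_of_def[of Q]
proof (rule measurable_measure_of)
  show "{U. openin Q U} \<subseteq> Pow (topspace Q)" using openin_subset by blast
  show "h \<in> space (borel_of P) \<rightarrow> topspace Q" using assms by (auto simp: continuous_map_def)
  fix U assume "U \<in> {U. openin Q U}"
  then have "openin P {x \<in> topspace P. h x \<in> U}" using assms by (auto simp: continuous_map_def)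
  moreover have "h -` U \<inter> space (borel_of P) = {x \<in> topspace P. h x \<in> U}" by auto
  ultimately show "h -` U \<inter> space (borel_of P) \<in> sets (borel_of P)"
    unfolding borel_of_def using openin_subset by (intro in_measure_of) (blast, simp)
qed

lemma polish_topology_lepoll:
  assumes "polish_topology P"
  shows "topspace P \<lesssim> (UNIV :: real set)"
proof -
  have haus: "Hausdorff_space P"
    using assms by (simp add: polish_topology_def completely_metrizable_imp_metrizable_space
        metrizable_imp_Hausdorff_space)
  obtain \<B> where \<B>: "countable \<B>" "\<And>V. V \<in> \<B> \<Longrightarrow> openin P V"
      "\<And>U x. openin P U \<Longrightarrow> x \<in> U \<Longrightarrow> \<exists>V\<in>\<B>. x \<in> V \<and> V \<subseteq> U"
    using assms unfolding polish_topology_def second_countable_def by metis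
  define code where "code x = to_nat_on \<B> ` {V \<in> \<B>. x \<in> V}" for x
  have "inj_on code (topspace P)"
  proof (rule inj_onI, rule ccontr)
    fix x y assume xy: "x \<in> topspace P" "y \<in> topspace P" "code x = code y" "x \<noteq> y"
    then obtain U U' where "openin P U" "x \<in> U" "y \<in> U'" "disjnt U U'"
      using haus unfolding Hausdorff_space_def by metis
    then obtain V where V: "V \<in> \<B>" "x \<in> V" "y \<notin> V"
      using \<B>(3) by (metis disjnt_iff subsetD)
    then have "to_nat_on \<B> V \<in> code y" using xy(3) unfolding code_def by blast
    then show False
      using V \<B>(1) inj_on_to_nat_on[OF \<B>(1)] unfolding code_def by (auto dest: inj_onD)
  qed
  then have "topspace P \<lesssim> (UNIV :: nat set set)" unfolding lepoll_def by blast
  then show ?thesis using nat_sets_eqpoll_reals lepoll_trans2 by blast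
qed

lemma polish_topology_on_reals:
  assumes "polish_topology P"
  obtains Q :: "real topology" and h k where "polish_topology Q" "homeomorphic_maps P Q h k"
proof -
  obtain h :: "'a \<Rightarrow> real" where inj: "inj_on h (topspace P)"
    using polish_topology_lepoll[OF assms] unfolding lepoll_def by blast
  define k where "k = inv_into (topspace P) h"
  define Q where "Q = pullback_topology (h ` topspace P) k P"
  have kh: "k (h x) = x" if "x \<in> topspace P" for x
    using that inj by (simp add: k_def)
  have Q: "topspace Q = h ` topspace P"
    unfolding Q_def topspace_pullback_topology using kh by auto
  have "continuous_map Q P k"
    using continuous_map_pullback[of P P id "h ` topspace P" k] by (simp add: Q_def)
  moreover have "continuous_map P Q h"
    unfolding continuous_map_def
  proof (intro conjI allI impI)
    show "h \<in> topspace P \<rightarrow> topspace Q" using Q by auto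
    fix U assume "openin Q U"
    then obtain V where "openin P V" "U = k -` V \<inter> h ` topspace P"
      unfolding Q_def openin_pullback_topology by auto
    moreover from this have "{x \<in> topspace P. h x \<in> U} = topspace P \<inter> V"
      by (auto simp: kh) (metis kh)
    ultimately show "openin P {x \<in> topspace P. h x \<in> U}" by (simp add: openin_Int)
  qed
  ultimately have hk: "homeomorphic_maps P Q h k"
    using Q kh by (auto simp: homeomorphic_maps_def)
  then have "P homeomorphic_space Q" by (auto simp: homeomorphic_space_def)
  then have "polish_topology Q"
    using assms homeomorphic_completely_metrizable_space homeomorphic_space_second_countability
    unfolding polish_topology_def by blast
  with hk that show ?thesis by blast
qed

lemma standard_borelI:
  fixes P :: "'c topology"
  assumes P: "polish_topology P" and B: "B \<in> sets (borel_of P)"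
    and iso: "measurable_iso M (restrict_space (borel_of P) B)"
  shows "standard_borel M"
proof -
  obtain Q :: "real topology" and h k where Q: "polish_topology Q" "homeomorphic_maps P Q h k"
    using polish_topology_on_reals[OF P] .
  have h: "h \<in> borel_of P \<rightarrow>\<^sub>M borel_of Q" and k: "k \<in> borel_of Q \<rightarrow>\<^sub>M borel_of P"
    using Q(2) by (auto simp: homeomorphic_maps_def intro: borel_of_continuous_map)
  have kh: "\<And>x. x \<in> topspace P \<Longrightarrow> k (h x) = x" and hk: "\<And>y. y \<in> topspace Q \<Longrightarrow> h (k y) = y"
    using Q(2) by (auto simp: homeomorphic_maps_def)
  define B' where "B' = k -` B \<inter> space (borel_of Q)"
  have B': "B' \<in> sets (borel_of Q)" unfolding B'_def using k B by (rule measurable_sets)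
  have BP: "B \<subseteq> topspace P" using sets.sets_into_space[OF B] by simp
  let ?N = "restrict_space (borel_of P) B" and ?N' = "restrict_space (borel_of Q) B'"
  have spN: "space ?N = B" and spN': "space ?N' = B'"
    using BP by (auto simp: space_restrict_space B'_def)
  obtain \<phi> \<psi> where \<phi>: "\<phi> \<in> M \<rightarrow>\<^sub>M ?N" and \<psi>: "\<psi> \<in> ?N \<rightarrow>\<^sub>M M"
    and inv: "\<And>x. x \<in> space M \<Longrightarrow> \<psi> (\<phi> x) = x" "\<And>y. y \<in> B \<Longrightarrow> \<phi> (\<psi> y) = y"
    using iso unfolding measurable_iso_def spN by blast
  have hB: "h \<in> ?N \<rightarrow>\<^sub>M ?N'"
    using h BP kh measurable_space[OF h]
    by (intro measurable_restrict_space2 measurable_restrict_space1) (auto simp: spN B'_def)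
  have kB: "k \<in> ?N' \<rightarrow>\<^sub>M ?N"
    using k by (intro measurable_restrict_space2 measurable_restrict_space1) (auto simp: spN', auto simp: B'_def)
  have "measurable_iso M ?N'"
    unfolding measurable_iso_def
  proof (intro bexI conjI ballI)
    show "h \<circ> \<phi> \<in> M \<rightarrow>\<^sub>M ?N'" using \<phi> hB by (rule measurable_comp)
    show "\<psi> \<circ> k \<in> ?N' \<rightarrow>\<^sub>M M" using kB \<psi> by (rule measurable_comp)
    fix x assume "x \<in> space M"
    then show "(\<psi> \<circ> k) ((h \<circ> \<phi>) x) = x"
      using inv(1) kh subsetD[OF BP] measurable_space[OF \<phi>] spN by simp
  next
    fix y assume "y \<in> space ?N'"
    then show "(h \<circ> \<phi>) ((\<psi> \<circ> k) y) = y" using inv hk spN' by (auto simp: B'_def)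
  qed
  with Q(1) B' show ?thesis
    unfolding standard_borel_def by (intro exI[of _ Q] exI[of _ B'] conjI)
qed

section \<open>MT-spaces\<close>

record 'a mt_struct =
  mt_sigma :: "'a measure"
  mt_top :: "'a topology"

definition mt_space :: "'a mt_struct \<Rightarrow> bool" where
  "mt_space X \<longleftrightarrow> space (mt_sigma X) = topspace (mt_top X)"

definition mt_map :: "'a mt_struct \<Rightarrow> 'b mt_struct \<Rightarrow> ('a \<Rightarrow> 'b) \<Rightarrow> bool" where
  "mt_map X Y f \<longleftrightarrow> f \<in> mt_sigma X \<rightarrow>\<^sub>M mt_sigma Y \<and> continuous_map (mt_top X) (mt_top Y) f"

definition mt_prod :: "'a mt_struct \<Rightarrow> 'b mt_struct \<Rightarrow> ('a \<times> 'b) mt_struct" where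
  "mt_prod X Y = \<lparr>mt_sigma = mt_sigma X \<Otimes>\<^sub>M mt_sigma Y, mt_top = prod_topology (mt_top X) (mt_top Y)\<rparr>"

definition mt_borel :: "'a topology \<Rightarrow> 'a mt_struct" where
  "mt_borel P = \<lparr>mt_sigma = borel_of P, mt_top = P\<rparr>"

definition mt_discrete :: "'a measure \<Rightarrow> 'a mt_struct" where
  "mt_discrete T = \<lparr>mt_sigma = T, mt_top = discrete_topology (space T)\<rparr>"

definition mt_homotopic :: "'a mt_struct \<Rightarrow> 'b mt_struct \<Rightarrow> ('a \<Rightarrow> 'b) \<Rightarrow> ('a \<Rightarrow> 'b) \<Rightarrow> bool" where
  "mt_homotopic X Y f g \<longleftrightarrow>
     (\<exists>H. mt_map (mt_prod X (mt_borel (top_of_set {0..1::real}))) Y H \<and>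
        (\<forall>x\<in>topspace (mt_top X). H (x, 0) = f x \<and> H (x, 1) = g x))"

section \<open>Standard coefficients\<close>

record 'g sigma_ring = "'g ring" +
  coeff_sigma :: "'g measure"

text \<open>For a group, only the additive structure of the record is constrained and used. The locale
  \<open>ring\<close> is that of not necessarily commutative rings with unit.\<close>

definition standard_group :: "'g sigma_ring \<Rightarrow> bool" where
  "standard_group \<Gamma> \<longleftrightarrow>
     abelian_group \<Gamma> \<and>
     space (coeff_sigma \<Gamma>) = carrier \<Gamma> \<and> standard_borel (coeff_sigma \<Gamma>) \<and>
     (\<lambda>(a, b). a \<oplus>\<^bsub>\<Gamma>\<^esub> b) \<in> coeff_sigma \<Gamma> \<Otimes>\<^sub>M coeff_sigma \<Gamma> \<rightarrow>\<^sub>M coeff_sigma \<Gamma> \<and>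
     (\<lambda>a. \<ominus>\<^bsub>\<Gamma>\<^esub> a) \<in> coeff_sigma \<Gamma> \<rightarrow>\<^sub>M coeff_sigma \<Gamma>"

definition standard_ring :: "'g sigma_ring \<Rightarrow> bool" where
  "standard_ring \<Gamma> \<longleftrightarrow>
     ring \<Gamma> \<and>
     space (coeff_sigma \<Gamma>) = carrier \<Gamma> \<and> standard_borel (coeff_sigma \<Gamma>) \<and>
     (\<lambda>(a, b). a \<oplus>\<^bsub>\<Gamma>\<^esub> b) \<in> coeff_sigma \<Gamma> \<Otimes>\<^sub>M coeff_sigma \<Gamma> \<rightarrow>\<^sub>M coeff_sigma \<Gamma> \<and>
     (\<lambda>a. \<ominus>\<^bsub>\<Gamma>\<^esub> a) \<in> coeff_sigma \<Gamma> \<rightarrow>\<^sub>M coeff_sigma \<Gamma> \<and>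
     (\<lambda>(a, b). a \<otimes>\<^bsub>\<Gamma>\<^esub> b) \<in> coeff_sigma \<Gamma> \<Otimes>\<^sub>M coeff_sigma \<Gamma> \<rightarrow>\<^sub>M coeff_sigma \<Gamma>"

section \<open>Measurable singular cohomology\<close>

abbreviation simplex_top :: "nat \<Rightarrow> (nat \<Rightarrow> real) topology" where
  "simplex_top n \<equiv> subtopology (powertop_real UNIV) (standard_simplex n)"

definition measurable_simplex ::
    "nat \<Rightarrow> 'a mt_struct \<Rightarrow> 't measure \<Rightarrow> ((nat \<Rightarrow> real) \<times> 't \<Rightarrow> 'a) \<Rightarrow> bool" where
  "measurable_simplex n X T \<sigma> \<longleftrightarrow>
     standard_borel T \<and> mt_map (mt_prod (mt_borel (simplex_top n)) (mt_discrete T)) X \<sigma>"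

definition cochain_group ::
    "nat \<Rightarrow> 'a topology \<Rightarrow> 'g sigma_ring \<Rightarrow> (((nat \<Rightarrow> real) \<Rightarrow> 'a) \<Rightarrow> 'g) monoid" where
  "cochain_group n S \<Gamma> = product_group (singular_simplex_set n S) (\<lambda>_. add_monoid \<Gamma>)"

definition coboundary ::
    "nat \<Rightarrow> 'a topology \<Rightarrow> 'g sigma_ring \<Rightarrow>
      (((nat \<Rightarrow> real) \<Rightarrow> 'a) \<Rightarrow> 'g) \<Rightarrow> (((nat \<Rightarrow> real) \<Rightarrow> 'a) \<Rightarrow> 'g)" where
  "coboundary n S \<Gamma> \<omega> =
     (\<lambda>\<sigma>\<in>singular_simplex_set (Suc n) S.
        \<Oplus>\<^bsub>\<Gamma>\<^esub>k\<in>{..Suc n}. add_pow \<Gamma> ((-1::int) ^ k) (\<omega> (singular_face (Suc n) k \<sigma>)))"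

text \<open>A standard Borel space has at most the cardinality of the continuum, so every one is
  isomorphic to one whose points are real numbers (with an arbitrary standard Borel \<open>\<sigma>\<close>-algebra);
  hence it suffices to let \<open>T\<close> range over these (see \<open>measurable_cochain_any\<close> below).\<close>

definition measurable_cochain ::
    "nat \<Rightarrow> 'a mt_struct \<Rightarrow> 'g sigma_ring \<Rightarrow> (((nat \<Rightarrow> real) \<Rightarrow> 'a) \<Rightarrow> 'g) \<Rightarrow> bool" where
  "measurable_cochain n X \<Gamma> \<omega> \<longleftrightarrow>
     (\<forall>(T :: real measure) \<sigma>. measurable_simplex n X T \<sigma> \<longrightarrow>
        (\<lambda>t. \<omega> (\<lambda>x\<in>standard_simplex n. \<sigma> (x, t))) \<in> T \<rightarrow>\<^sub>M coeff_sigma \<Gamma>)"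

lemma measurable_cochain_any:
  fixes T :: "'t measure"
  assumes \<omega>: "measurable_cochain n X \<Gamma> \<omega>" and \<sigma>: "measurable_simplex n X T \<sigma>"
  shows "(\<lambda>t. \<omega> (\<lambda>x\<in>standard_simplex n. \<sigma> (x, t))) \<in> T \<rightarrow>\<^sub>M coeff_sigma \<Gamma>"
proof -
  obtain P :: "real topology" and B where P: "polish_topology P" "B \<in> sets (borel_of P)"
    and iso: "measurable_iso T (restrict_space (borel_of P) B)"
    using \<sigma> unfolding measurable_simplex_def standard_borel_def by auto
  define N where "N = restrict_space (borel_of P) B"
  have "measurable_iso N N" unfolding measurable_iso_def by (intro bexI[of _ "\<lambda>x. x"]) auto
  with P have N: "standard_borel N"
    unfolding standard_borel_def N_def by (intro exI[of _ P] exI[of _ B] conjI)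
  obtain \<phi> \<psi> where \<phi>: "\<phi> \<in> T \<rightarrow>\<^sub>M N" and \<psi>: "\<psi> \<in> N \<rightarrow>\<^sub>M T"
    and inv: "\<And>t. t \<in> space T \<Longrightarrow> \<psi> (\<phi> t) = t"
    using iso unfolding measurable_iso_def N_def by blast
  let ?\<sigma> = "\<sigma> \<circ> map_prod id \<psi>"
  have \<sigma>1: "\<sigma> \<in> borel_of (simplex_top n) \<Otimes>\<^sub>M T \<rightarrow>\<^sub>M mt_sigma X"
    and \<sigma>2: "continuous_map (prod_topology (simplex_top n) (discrete_topology (space T))) (mt_top X) \<sigma>"
    using \<sigma> unfolding measurable_simplex_def mt_map_def mt_prod_def mt_borel_def mt_discrete_def
      mt_struct.simps by blast+
  have "map_prod id \<psi> \<in> borel_of (simplex_top n) \<Otimes>\<^sub>M N \<rightarrow>\<^sub>M borel_of (simplex_top n) \<Otimes>\<^sub>M T"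
  proof (rule measurable_pair)
    show "fst \<circ> map_prod id \<psi> \<in> borel_of (simplex_top n) \<Otimes>\<^sub>M N \<rightarrow>\<^sub>M borel_of (simplex_top n)"
      unfolding fst_comp_map_prod id_comp by (rule measurable_fst)
    show "snd \<circ> map_prod id \<psi> \<in> borel_of (simplex_top n) \<Otimes>\<^sub>M N \<rightarrow>\<^sub>M T"
      unfolding snd_comp_map_prod using measurable_snd \<psi> by (rule measurable_comp)
  qed
  then have "?\<sigma> \<in> borel_of (simplex_top n) \<Otimes>\<^sub>M N \<rightarrow>\<^sub>M mt_sigma X"
    using \<sigma>1 by (rule measurable_comp)
  moreover have "continuous_map (prod_topology (simplex_top n) (discrete_topology (space N))) (mt_top X) ?\<sigma>"
  proof -
    have "continuous_map (discrete_topology (space N)) (discrete_topology (space T)) \<psi>"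
      using measurable_space[OF \<psi>] by (auto simp: continuous_map_def)
    then have "continuous_map (prod_topology (simplex_top n) (discrete_topology (space N)))
        (prod_topology (simplex_top n) (discrete_topology (space T))) (map_prod id \<psi>)"
      by (simp add: map_prod_def continuous_map_prod_top)
    then show ?thesis using \<sigma>2 by (rule continuous_map_compose)
  qed
  ultimately have "measurable_simplex n X N ?\<sigma>"
    using N unfolding measurable_simplex_def mt_map_def mt_prod_def mt_borel_def mt_discrete_def
      mt_struct.simps by blast
  then have "(\<lambda>u. \<omega> (\<lambda>x\<in>standard_simplex n. ?\<sigma> (x, u))) \<in> N \<rightarrow>\<^sub>M coeff_sigma \<Gamma>"
    using \<omega> unfolding measurable_cochain_def by blast
  from measurable_compose[OF \<phi> this] show ?thesis
  proof (rule measurable_cong[THEN iffD1, rotated])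
    fix t assume "t \<in> space T"
    then show "\<omega> (\<lambda>x\<in>standard_simplex n. ?\<sigma> (x, \<phi> t)) = \<omega> (\<lambda>x\<in>standard_simplex n. \<sigma> (x, t))"
      by (simp add: inv)
  qed
qed

definition mt_cochain_group ::
    "nat \<Rightarrow> 'a mt_struct \<Rightarrow> 'g sigma_ring \<Rightarrow> (((nat \<Rightarrow> real) \<Rightarrow> 'a) \<Rightarrow> 'g) monoid" where
  "mt_cochain_group n X \<Gamma> =
     (cochain_group n (mt_top X) \<Gamma>)
       \<lparr>carrier := {\<omega> \<in> carrier (cochain_group n (mt_top X) \<Gamma>). measurable_cochain n X \<Gamma> \<omega>}\<rparr>"

definition mt_cocycles ::
    "nat \<Rightarrow> 'a mt_struct \<Rightarrow> 'g sigma_ring \<Rightarrow> (((nat \<Rightarrow> real) \<Rightarrow> 'a) \<Rightarrow> 'g) set" where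
  "mt_cocycles n X \<Gamma> =
     kernel (mt_cochain_group n X \<Gamma>) (mt_cochain_group (Suc n) X \<Gamma>) (coboundary n (mt_top X) \<Gamma>)"

definition mt_coboundaries ::
    "nat \<Rightarrow> 'a mt_struct \<Rightarrow> 'g sigma_ring \<Rightarrow> (((nat \<Rightarrow> real) \<Rightarrow> 'a) \<Rightarrow> 'g) set" where
  "mt_coboundaries n X \<Gamma> =
     (case n of
        0 \<Rightarrow> {\<one>\<^bsub>mt_cochain_group 0 X \<Gamma>\<^esub>}
      | Suc m \<Rightarrow> coboundary m (mt_top X) \<Gamma> ` carrier (mt_cochain_group m X \<Gamma>))"

definition mt_cohomology ::
    "nat \<Rightarrow> 'a mt_struct \<Rightarrow> 'g sigma_ring \<Rightarrow> (((nat \<Rightarrow> real) \<Rightarrow> 'a) \<Rightarrow> 'g) set monoid" where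
  "mt_cohomology n X \<Gamma> =
     (mt_cochain_group n X \<Gamma>)\<lparr>carrier := mt_cocycles n X \<Gamma>\<rparr> Mod mt_coboundaries n X \<Gamma>"

definition cochain_pullback ::
    "nat \<Rightarrow> 'a topology \<Rightarrow> ('a \<Rightarrow> 'b) \<Rightarrow> (((nat \<Rightarrow> real) \<Rightarrow> 'b) \<Rightarrow> 'g) \<Rightarrow> (((nat \<Rightarrow> real) \<Rightarrow> 'a) \<Rightarrow> 'g)" where
  "cochain_pullback n S f \<omega> = (\<lambda>\<sigma>\<in>singular_simplex_set n S. \<omega> (simplex_map n f \<sigma>))"

text \<open>The class of \<open>\<omega>\<close> is sent to the class of its pullback. The union merely avoids choosing a
  representative, as all classes in it coincide (see \<open>mt_cohomology_map_class\<close> below).\<close>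

definition mt_cohomology_map ::
    "nat \<Rightarrow> 'a mt_struct \<Rightarrow> 'b mt_struct \<Rightarrow> 'g sigma_ring \<Rightarrow> ('a \<Rightarrow> 'b) \<Rightarrow>
      (((nat \<Rightarrow> real) \<Rightarrow> 'b) \<Rightarrow> 'g) set \<Rightarrow> (((nat \<Rightarrow> real) \<Rightarrow> 'a) \<Rightarrow> 'g) set" where
  "mt_cohomology_map n X Y \<Gamma> f =
     (\<lambda>c\<in>carrier (mt_cohomology n Y \<Gamma>).
        \<Union>\<omega>\<in>c. mt_coboundaries n X \<Gamma> #>\<^bsub>mt_cochain_group n X \<Gamma>\<^esub> cochain_pullback n (mt_top X) f \<omega>)"

lemma standard_group_or_ringD:
  assumes "standard_group \<Gamma> \<or> standard_ring \<Gamma>"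
  shows "abelian_group \<Gamma>" "space (coeff_sigma \<Gamma>) = carrier \<Gamma>"
    "(\<lambda>(a, b). a \<oplus>\<^bsub>\<Gamma>\<^esub> b) \<in> coeff_sigma \<Gamma> \<Otimes>\<^sub>M coeff_sigma \<Gamma> \<rightarrow>\<^sub>M coeff_sigma \<Gamma>"
    "(\<lambda>a. \<ominus>\<^bsub>\<Gamma>\<^esub> a) \<in> coeff_sigma \<Gamma> \<rightarrow>\<^sub>M coeff_sigma \<Gamma>"
  using assms by (auto simp: standard_group_def standard_ring_def dest: ring.is_abelian_group)

lemma cochain_group_simps:
  "carrier (cochain_group n S \<Gamma>) = singular_simplex_set n S \<rightarrow>\<^sub>E carrier \<Gamma>"
  "\<omega> \<otimes>\<^bsub>cochain_group n S \<Gamma>\<^esub> \<eta> = (\<lambda>\<sigma>\<in>singular_simplex_set n S. \<omega> \<sigma> \<oplus>\<^bsub>\<Gamma>\<^esub> \<eta> \<sigma>)"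
  "\<one>\<^bsub>cochain_group n S \<Gamma>\<^esub> = (\<lambda>\<sigma>\<in>singular_simplex_set n S. \<zero>\<^bsub>\<Gamma>\<^esub>)"
  by (simp_all add: cochain_group_def)

lemma mt_cochain_group_simps:
  "carrier (mt_cochain_group n X \<Gamma>) =
     {\<omega> \<in> singular_simplex_set n (mt_top X) \<rightarrow>\<^sub>E carrier \<Gamma>. measurable_cochain n X \<Gamma> \<omega>}"
  "\<omega> \<otimes>\<^bsub>mt_cochain_group n X \<Gamma>\<^esub> \<eta> = (\<lambda>\<sigma>\<in>singular_simplex_set n (mt_top X). \<omega> \<sigma> \<oplus>\<^bsub>\<Gamma>\<^esub> \<eta> \<sigma>)"
  "\<one>\<^bsub>mt_cochain_group n X \<Gamma>\<^esub> = (\<lambda>\<sigma>\<in>singular_simplex_set n (mt_top X). \<zero>\<^bsub>\<Gamma>\<^esub>)"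
  by (simp_all add: mt_cochain_group_def cochain_group_simps)

lemma singular_simplex_slice:
  assumes "measurable_simplex n X T \<sigma>" "t \<in> space T"
  shows "singular_simplex n (mt_top X) (\<lambda>x\<in>standard_simplex n. \<sigma> (x, t))"
proof -
  have "continuous_map (simplex_top n) (prod_topology (simplex_top n) (discrete_topology (space T)))
      (\<lambda>x. (x, t))"
    using assms(2) by (intro continuous_map_pairedI) auto
  moreover have "continuous_map (prod_topology (simplex_top n) (discrete_topology (space T))) (mt_top X) \<sigma>"
    using assms(1) by (simp add: measurable_simplex_def mt_map_def mt_prod_def mt_borel_def mt_discrete_def)
  ultimately have "continuous_map (simplex_top n) (mt_top X) (\<lambda>x. \<sigma> (x, t))"
    using continuous_map_compose by (fastforce simp: o_def)
  then have "continuous_map (simplex_top n) (mt_top X) (\<lambda>x\<in>standard_simplex n. \<sigma> (x, t))"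
    by (rule continuous_map_eq) (simp add: topspace_standard_simplex)
  then show ?thesis by (simp add: singular_simplex_def)
qed

lemma group_cochain_group:
  assumes "abelian_group \<Gamma>"
  shows "group (cochain_group n S \<Gamma>)"
  using assms unfolding cochain_group_def by (intro product_group abelian_group.a_group)

lemma subgroup_mt_cochains:
  assumes \<Gamma>: "standard_group \<Gamma> \<or> standard_ring \<Gamma>"
  shows "subgroup (carrier (mt_cochain_group n X \<Gamma>)) (cochain_group n (mt_top X) \<Gamma>)"
proof -
  note G = standard_group_or_ringD[OF \<Gamma>]
  interpret abelian_group \<Gamma> by (rule G)
  interpret C: group "cochain_group n (mt_top X) \<Gamma>" by (rule group_cochain_group[OF G(1)])
  let ?S = "singular_simplex_set n (mt_top X)"
  show ?thesis
  proof (rule C.subgroupI)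
    show "carrier (mt_cochain_group n X \<Gamma>) \<subseteq> carrier (cochain_group n (mt_top X) \<Gamma>)"
      by (auto simp: mt_cochain_group_simps cochain_group_simps)
    have "measurable_cochain n X \<Gamma> (\<lambda>\<sigma>\<in>?S. \<zero>\<^bsub>\<Gamma>\<^esub>)"
      unfolding measurable_cochain_def
    proof (intro allI impI)
      fix T :: "real measure" and \<sigma> assume \<sigma>: "measurable_simplex n X T \<sigma>"
      have "(\<lambda>t. \<zero>\<^bsub>\<Gamma>\<^esub>) \<in> T \<rightarrow>\<^sub>M coeff_sigma \<Gamma>" using G(2) by (intro measurable_const) simp
      then show "(\<lambda>t. (\<lambda>\<sigma>\<in>?S. \<zero>\<^bsub>\<Gamma>\<^esub>) (\<lambda>x\<in>standard_simplex n. \<sigma> (x, t))) \<in> T \<rightarrow>\<^sub>M coeff_sigma \<Gamma>"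
        by (rule measurable_cong[THEN iffD1, rotated]) (simp add: singular_simplex_slice[OF \<sigma>])
    qed
    then have "(\<lambda>\<sigma>\<in>?S. \<zero>\<^bsub>\<Gamma>\<^esub>) \<in> carrier (mt_cochain_group n X \<Gamma>)"
      by (auto simp: mt_cochain_group_simps)
    then show "carrier (mt_cochain_group n X \<Gamma>) \<noteq> {}" by blast
  next
    fix \<omega> assume \<omega>: "\<omega> \<in> carrier (mt_cochain_group n X \<Gamma>)"
    then have inv: "inv\<^bsub>cochain_group n (mt_top X) \<Gamma>\<^esub> \<omega> = (\<lambda>\<sigma>\<in>?S. \<ominus>\<^bsub>\<Gamma>\<^esub> \<omega> \<sigma>)"
      using a_group unfolding cochain_group_def mt_cochain_group_simps
      by (subst inv_product_group) (auto simp: a_inv_def)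
    have "measurable_cochain n X \<Gamma> (\<lambda>\<sigma>\<in>?S. \<ominus>\<^bsub>\<Gamma>\<^esub> \<omega> \<sigma>)"
      unfolding measurable_cochain_def
    proof (intro allI impI)
      fix T :: "real measure" and \<sigma> assume \<sigma>: "measurable_simplex n X T \<sigma>"
      have "(\<lambda>t. \<omega> (\<lambda>x\<in>standard_simplex n. \<sigma> (x, t))) \<in> T \<rightarrow>\<^sub>M coeff_sigma \<Gamma>"
        using \<omega> \<sigma> by (auto simp: mt_cochain_group_simps measurable_cochain_def)
      from measurable_compose[OF this G(4)]
      show "(\<lambda>t. (\<lambda>\<sigma>\<in>?S. \<ominus>\<^bsub>\<Gamma>\<^esub> \<omega> \<sigma>) (\<lambda>x\<in>standard_simplex n. \<sigma> (x, t))) \<in> T \<rightarrow>\<^sub>M coeff_sigma \<Gamma>"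
        by (rule measurable_cong[THEN iffD1, rotated]) (simp add: singular_simplex_slice[OF \<sigma>])
    qed
    with \<omega> show "inv\<^bsub>cochain_group n (mt_top X) \<Gamma>\<^esub> \<omega> \<in> carrier (mt_cochain_group n X \<Gamma>)"
      unfolding inv by (auto simp: mt_cochain_group_simps)
  next
    fix \<omega> \<eta> assume \<omega>: "\<omega> \<in> carrier (mt_cochain_group n X \<Gamma>)" and \<eta>: "\<eta> \<in> carrier (mt_cochain_group n X \<Gamma>)"
    have "measurable_cochain n X \<Gamma> (\<lambda>\<sigma>\<in>?S. \<omega> \<sigma> \<oplus>\<^bsub>\<Gamma>\<^esub> \<eta> \<sigma>)"
      unfolding measurable_cochain_def
    proof (intro allI impI)
      fix T :: "real measure" and \<sigma> assume \<sigma>: "measurable_simplex n X T \<sigma>"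
      let ?s = "\<lambda>t. \<lambda>x\<in>standard_simplex n. \<sigma> (x, t)"
      have "(\<lambda>t. \<omega> (?s t)) \<in> T \<rightarrow>\<^sub>M coeff_sigma \<Gamma>" "(\<lambda>t. \<eta> (?s t)) \<in> T \<rightarrow>\<^sub>M coeff_sigma \<Gamma>"
        using \<omega> \<eta> \<sigma> by (auto simp: mt_cochain_group_simps measurable_cochain_def)
      then have "(\<lambda>t. (\<omega> (?s t), \<eta> (?s t))) \<in> T \<rightarrow>\<^sub>M coeff_sigma \<Gamma> \<Otimes>\<^sub>M coeff_sigma \<Gamma>"
        by (rule measurable_Pair)
      from measurable_compose[OF this G(3)]
      show "(\<lambda>t. (\<lambda>\<sigma>\<in>?S. \<omega> \<sigma> \<oplus>\<^bsub>\<Gamma>\<^esub> \<eta> \<sigma>) (?s t)) \<in> T \<rightarrow>\<^sub>M coeff_sigma \<Gamma>"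
        by (rule measurable_cong[THEN iffD1, rotated]) (simp add: singular_simplex_slice[OF \<sigma>])
    qed
    with \<omega> \<eta> show "\<omega> \<otimes>\<^bsub>cochain_group n (mt_top X) \<Gamma>\<^esub> \<eta> \<in> carrier (mt_cochain_group n X \<Gamma>)"
      by (auto simp: mt_cochain_group_simps cochain_group_simps)
  qed
qed

lemma group_mt_cochain_group:
  assumes "standard_group \<Gamma> \<or> standard_ring \<Gamma>"
  shows "group (mt_cochain_group n X \<Gamma>)"
proof -
  have "mt_cochain_group n X \<Gamma> =
      (cochain_group n (mt_top X) \<Gamma>)\<lparr>carrier := carrier (mt_cochain_group n X \<Gamma>)\<rparr>"
    by (simp add: mt_cochain_group_def)
  then show ?thesis
    using subgroup.subgroup_is_group[OF subgroup_mt_cochains[OF assms]]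
      group_cochain_group[OF standard_group_or_ringD(1)[OF assms]] by metis
qed

lemma singular_face_mem:
  "\<sigma> \<in> singular_simplex_set (Suc n) S \<Longrightarrow> k \<le> Suc n \<Longrightarrow>
     singular_face (Suc n) k \<sigma> \<in> singular_simplex_set n S"
  using singular_simplex_singular_face[of "Suc n" S \<sigma> k] by simp

lemma coboundary_hom:
  assumes "abelian_group \<Gamma>"
  shows "coboundary n S \<Gamma> \<in> hom (cochain_group n S \<Gamma>) (cochain_group (Suc n) S \<Gamma>)"
proof -
  interpret abelian_group \<Gamma> by fact
  have pow: "add_pow \<Gamma> (i::int) a \<in> carrier \<Gamma>" if "a \<in> carrier \<Gamma>" for i a
    using add.int_pow_closed[OF that] .
  show ?thesis
  proof (rule homI)
    fix \<omega> assume \<omega>: "\<omega> \<in> carrier (cochain_group n S \<Gamma>)"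
    then show "coboundary n S \<Gamma> \<omega> \<in> carrier (cochain_group (Suc n) S \<Gamma>)"
      using singular_face_mem unfolding cochain_group_simps coboundary_def
      by (intro restrict_PiE_iff[THEN iffD2] ballI finsum_closed Pi_I pow) blast
  next
    fix \<omega> \<eta> assume \<omega>: "\<omega> \<in> carrier (cochain_group n S \<Gamma>)" and \<eta>: "\<eta> \<in> carrier (cochain_group n S \<Gamma>)"
    show "coboundary n S \<Gamma> (\<omega> \<otimes>\<^bsub>cochain_group n S \<Gamma>\<^esub> \<eta>) =
        coboundary n S \<Gamma> \<omega> \<otimes>\<^bsub>cochain_group (Suc n) S \<Gamma>\<^esub> coboundary n S \<Gamma> \<eta>"
      unfolding cochain_group_simps coboundary_def
    proof (rule restrict_ext)
      fix \<sigma> assume \<sigma>: "\<sigma> \<in> singular_simplex_set (Suc n) S"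
      let ?f = "\<lambda>k. singular_face (Suc n) k \<sigma>"
      have f: "?f k \<in> singular_simplex_set n S" if "k \<le> Suc n" for k
        using singular_face_mem[OF \<sigma> that] .
      have c: "\<omega> (?f k) \<in> carrier \<Gamma>" "\<eta> (?f k) \<in> carrier \<Gamma>" if "k \<le> Suc n" for k
        using f[OF that] \<omega> \<eta> by (auto simp: cochain_group_simps)
      have "(\<Oplus>\<^bsub>\<Gamma>\<^esub>k\<in>{..Suc n}. add_pow \<Gamma> ((-1::int) ^ k)
             ((\<lambda>\<sigma>\<in>singular_simplex_set n S. \<omega> \<sigma> \<oplus>\<^bsub>\<Gamma>\<^esub> \<eta> \<sigma>) (?f k)))
          = (\<Oplus>\<^bsub>\<Gamma>\<^esub>k\<in>{..Suc n}. add_pow \<Gamma> ((-1::int) ^ k) (\<omega> (?f k))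
               \<oplus>\<^bsub>\<Gamma>\<^esub> add_pow \<Gamma> ((-1::int) ^ k) (\<eta> (?f k)))"
      proof (rule finsum_cong')
        fix k assume "k \<in> {..Suc n}"
        then have k: "k \<le> Suc n" by simp
        show "add_pow \<Gamma> ((-1::int) ^ k) ((\<lambda>\<sigma>\<in>singular_simplex_set n S. \<omega> \<sigma> \<oplus>\<^bsub>\<Gamma>\<^esub> \<eta> \<sigma>) (?f k)) =
            add_pow \<Gamma> ((-1::int) ^ k) (\<omega> (?f k)) \<oplus>\<^bsub>\<Gamma>\<^esub> add_pow \<Gamma> ((-1::int) ^ k) (\<eta> (?f k))"
          using f[OF k] add.int_pow_distrib[OF c[OF k]] by simp
      qed (auto intro!: pow c)
      also have "\<dots> = (\<Oplus>\<^bsub>\<Gamma>\<^esub>k\<in>{..Suc n}. add_pow \<Gamma> ((-1::int) ^ k) (\<omega> (?f k))) \<oplus>\<^bsub>\<Gamma>\<^esub>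
          (\<Oplus>\<^bsub>\<Gamma>\<^esub>k\<in>{..Suc n}. add_pow \<Gamma> ((-1::int) ^ k) (\<eta> (?f k)))"
        by (rule finsum_addf) (auto intro!: pow c)
      finally show "(\<Oplus>\<^bsub>\<Gamma>\<^esub>k\<in>{..Suc n}. add_pow \<Gamma> ((-1::int) ^ k)
             ((\<lambda>\<sigma>\<in>singular_simplex_set n S. \<omega> \<sigma> \<oplus>\<^bsub>\<Gamma>\<^esub> \<eta> \<sigma>) (?f k)))
          = (\<lambda>\<sigma>\<in>singular_simplex_set (Suc n) S.
               \<Oplus>\<^bsub>\<Gamma>\<^esub>k\<in>{..Suc n}. add_pow \<Gamma> ((-1::int) ^ k) (\<omega> (singular_face (Suc n) k \<sigma>))) \<sigma> \<oplus>\<^bsub>\<Gamma>\<^esub>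
            (\<lambda>\<sigma>\<in>singular_simplex_set (Suc n) S.
               \<Oplus>\<^bsub>\<Gamma>\<^esub>k\<in>{..Suc n}. add_pow \<Gamma> ((-1::int) ^ k) (\<eta> (singular_face (Suc n) k \<sigma>))) \<sigma>"
        using \<sigma> by simp
    qed
  qed
qed

lemma subgroup_mt_coboundaries:
  assumes \<Gamma>: "standard_group \<Gamma> \<or> standard_ring \<Gamma>"
  shows "subgroup (mt_coboundaries n X \<Gamma>) (cochain_group n (mt_top X) \<Gamma>)"
proof -
  note G = standard_group_or_ringD[OF \<Gamma>]
  interpret group "cochain_group n (mt_top X) \<Gamma>" by (rule group_cochain_group[OF G(1)])
  show ?thesis
  proof (cases n)
    case 0
    then have "mt_coboundaries n X \<Gamma> = {\<one>\<^bsub>cochain_group n (mt_top X) \<Gamma>\<^esub>}"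
      by (simp add: mt_coboundaries_def mt_cochain_group_def)
    then show ?thesis using triv_subgroup by simp
  next
    case (Suc m)
    have "group_hom (cochain_group m (mt_top X) \<Gamma>) (cochain_group (Suc m) (mt_top X) \<Gamma>)
        (coboundary m (mt_top X) \<Gamma>)"
      by (intro group_hom.intro group_hom_axioms.intro group_cochain_group[OF G(1)]
          coboundary_hom[OF G(1)])
    from group_hom.subgroup_img_is_subgroup[OF this subgroup_mt_cochains[OF \<Gamma>]]
    show ?thesis by (simp add: Suc mt_coboundaries_def)
  qed
qed

lemma simplex_map_mem:
  "mt_map X Y f \<Longrightarrow> \<sigma> \<in> singular_simplex_set n (mt_top X) \<Longrightarrow>
     simplex_map n f \<sigma> \<in> singular_simplex_set n (mt_top Y)"
  by (auto simp: mt_map_def intro: singular_simplex_simplex_map)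

lemma cochain_pullback_mt_cochain:
  assumes f: "mt_map X Y f" and \<omega>: "\<omega> \<in> carrier (mt_cochain_group n Y \<Gamma>)"
  shows "cochain_pullback n (mt_top X) f \<omega> \<in> carrier (mt_cochain_group n X \<Gamma>)"
proof -
  have "measurable_cochain n X \<Gamma> (cochain_pullback n (mt_top X) f \<omega>)"
    unfolding measurable_cochain_def
  proof (intro allI impI)
    fix T :: "real measure" and \<sigma> assume \<sigma>: "measurable_simplex n X T \<sigma>"
    then have "measurable_simplex n Y T (f \<circ> \<sigma>)"
      using f unfolding measurable_simplex_def mt_map_def
      by (blast intro: measurable_comp continuous_map_compose)
    with \<omega> have "(\<lambda>t. \<omega> (\<lambda>x\<in>standard_simplex n. (f \<circ> \<sigma>) (x, t))) \<in> T \<rightarrow>\<^sub>M coeff_sigma \<Gamma>"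
      unfolding mt_cochain_group_simps measurable_cochain_def by blast
    then show "(\<lambda>t. cochain_pullback n (mt_top X) f \<omega> (\<lambda>x\<in>standard_simplex n. \<sigma> (x, t)))
        \<in> T \<rightarrow>\<^sub>M coeff_sigma \<Gamma>"
    proof (rule measurable_cong[THEN iffD1, rotated])
      fix t assume "t \<in> space T"
      moreover have "simplex_map n f (\<lambda>x\<in>standard_simplex n. \<sigma> (x, t)) =
          (\<lambda>x\<in>standard_simplex n. (f \<circ> \<sigma>) (x, t))"
        by (auto simp: simplex_map_def)
      ultimately show "\<omega> (\<lambda>x\<in>standard_simplex n. (f \<circ> \<sigma>) (x, t)) =
          cochain_pullback n (mt_top X) f \<omega> (\<lambda>x\<in>standard_simplex n. \<sigma> (x, t))"
        using singular_simplex_slice[OF \<sigma>] by (simp add: cochain_pullback_def)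
    qed
  qed
  with \<omega> simplex_map_mem[OF f] show ?thesis
    by (auto simp: mt_cochain_group_simps cochain_pullback_def)
qed

lemma cochain_pullback_coboundary:
  assumes "abelian_group \<Gamma>" and f: "mt_map X Y f"
    and \<omega>: "\<omega> \<in> carrier (cochain_group n (mt_top Y) \<Gamma>)"
  shows "cochain_pullback (Suc n) (mt_top X) f (coboundary n (mt_top Y) \<Gamma> \<omega>) =
    coboundary n (mt_top X) \<Gamma> (cochain_pullback n (mt_top X) f \<omega>)"
proof -
  interpret abelian_group \<Gamma> by fact
  show ?thesis
    unfolding cochain_pullback_def[of "Suc n"] coboundary_def[of n "mt_top X"]
  proof (rule restrict_ext)
    fix \<sigma> assume \<sigma>: "\<sigma> \<in> singular_simplex_set (Suc n) (mt_top X)"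
    have face: "singular_face (Suc n) k (simplex_map (Suc n) f \<sigma>) =
        simplex_map n f (singular_face (Suc n) k \<sigma>)" if "k \<le> Suc n" for k
      using simplical_face_in_standard_simplex[of "Suc n" k] that
      by (auto simp: singular_face_def simplex_map_def fun_eq_iff)
    have "coboundary n (mt_top Y) \<Gamma> \<omega> (simplex_map (Suc n) f \<sigma>) = (\<Oplus>\<^bsub>\<Gamma>\<^esub>k\<in>{..Suc n}.
        add_pow \<Gamma> ((-1::int) ^ k) (\<omega> (singular_face (Suc n) k (simplex_map (Suc n) f \<sigma>))))"
      using simplex_map_mem[OF f \<sigma>] unfolding coboundary_def by (rule restrict_apply')
    also have "\<dots> = (\<Oplus>\<^bsub>\<Gamma>\<^esub>k\<in>{..Suc n}. add_pow \<Gamma> ((-1::int) ^ k)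
        (cochain_pullback n (mt_top X) f \<omega> (singular_face (Suc n) k \<sigma>)))"
    proof (rule finsum_cong')
      have *: "\<omega> (simplex_map n f (singular_face (Suc n) k \<sigma>)) \<in> carrier \<Gamma>" if "k \<le> Suc n" for k
        using \<omega> simplex_map_mem[OF f singular_face_mem[OF \<sigma> that]] by (auto simp: cochain_group_simps)
      show "(\<lambda>k. add_pow \<Gamma> ((-1::int) ^ k)
          (cochain_pullback n (mt_top X) f \<omega> (singular_face (Suc n) k \<sigma>))) \<in> {..Suc n} \<rightarrow> carrier \<Gamma>"
        using * singular_face_mem[OF \<sigma>] add.int_pow_closed by (auto simp: cochain_pullback_def)
    qed (use face singular_face_mem[OF \<sigma>] in \<open>auto simp: cochain_pullback_def\<close>)
    finally show "coboundary n (mt_top Y) \<Gamma> \<omega> (simplex_map (Suc n) f \<sigma>) =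
        (\<Oplus>\<^bsub>\<Gamma>\<^esub>k\<in>{..Suc n}. add_pow \<Gamma> ((-1::int) ^ k)
          (cochain_pullback n (mt_top X) f \<omega> (singular_face (Suc n) k \<sigma>)))" .
  qed
qed

lemma cochain_pullback_mt_coboundary:
  assumes \<Gamma>: "standard_group \<Gamma> \<or> standard_ring \<Gamma>" and f: "mt_map X Y f"
    and b: "b \<in> mt_coboundaries n Y \<Gamma>"
  shows "cochain_pullback n (mt_top X) f b \<in> mt_coboundaries n X \<Gamma>"
proof (cases n)
  case 0
  with b have "b = (\<lambda>\<sigma>\<in>singular_simplex_set n (mt_top Y). \<zero>\<^bsub>\<Gamma>\<^esub>)"
    by (simp add: mt_coboundaries_def mt_cochain_group_simps)
  then have "cochain_pullback n (mt_top X) f b = (\<lambda>\<sigma>\<in>singular_simplex_set n (mt_top X). \<zero>\<^bsub>\<Gamma>\<^esub>)"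
    using simplex_map_mem[OF f] by (auto simp: cochain_pullback_def)
  then show ?thesis by (simp add: 0 mt_coboundaries_def mt_cochain_group_simps)
next
  case (Suc m)
  then obtain \<eta> where \<eta>: "\<eta> \<in> carrier (mt_cochain_group m Y \<Gamma>)" "b = coboundary m (mt_top Y) \<Gamma> \<eta>"
    using b by (auto simp: mt_coboundaries_def)
  moreover have "\<eta> \<in> carrier (cochain_group m (mt_top Y) \<Gamma>)"
    using \<eta>(1) by (simp add: mt_cochain_group_simps cochain_group_simps)
  ultimately show ?thesis
    using cochain_pullback_coboundary[OF standard_group_or_ringD(1)[OF \<Gamma>] f]
      cochain_pullback_mt_cochain[OF f \<eta>(1)]
    by (auto simp: Suc mt_coboundaries_def)
qed

lemma mt_cohomology_map_class:
  assumes \<Gamma>: "standard_group \<Gamma> \<or> standard_ring \<Gamma>" and f: "mt_map X Y f"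
    and \<omega>: "\<omega> \<in> mt_cocycles n Y \<Gamma>"
  shows "mt_cohomology_map n X Y \<Gamma> f (mt_coboundaries n Y \<Gamma> #>\<^bsub>mt_cochain_group n Y \<Gamma>\<^esub> \<omega>) =
    mt_coboundaries n X \<Gamma> #>\<^bsub>mt_cochain_group n X \<Gamma>\<^esub> cochain_pullback n (mt_top X) f \<omega>"
proof -
  note G = standard_group_or_ringD[OF \<Gamma>]
  interpret CX: group "cochain_group n (mt_top X) \<Gamma>" by (rule group_cochain_group[OF G(1)])
  let ?p = "cochain_pullback n (mt_top X) f"
  let ?BX = "mt_coboundaries n X \<Gamma>" and ?BY = "mt_coboundaries n Y \<Gamma>"
  interpret BX: subgroup ?BX "cochain_group n (mt_top X) \<Gamma>" by (rule subgroup_mt_coboundaries[OF \<Gamma>])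
  have \<omega>': "\<omega> \<in> carrier (mt_cochain_group n Y \<Gamma>)"
    using \<omega> by (simp add: mt_cocycles_def kernel_def)
  have p\<omega>: "?p \<omega> \<in> carrier (cochain_group n (mt_top X) \<Gamma>)"
    using cochain_pullback_mt_cochain[OF f \<omega>'] by (simp add: mt_cochain_group_simps cochain_group_simps)
  have rX: "B #>\<^bsub>mt_cochain_group n X \<Gamma>\<^esub> \<eta> = B #>\<^bsub>cochain_group n (mt_top X) \<Gamma>\<^esub> \<eta>" for B \<eta>
    by (simp add: r_coset_def mt_cochain_group_def)
  have eq: "?BX #>\<^bsub>mt_cochain_group n X \<Gamma>\<^esub> ?p \<eta> = ?BX #>\<^bsub>mt_cochain_group n X \<Gamma>\<^esub> ?p \<omega>"
    if \<eta>: "\<eta> \<in> ?BY #>\<^bsub>mt_cochain_group n Y \<Gamma>\<^esub> \<omega>" for \<eta>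
  proof -
    obtain b where b: "b \<in> ?BY" "\<eta> = b \<otimes>\<^bsub>mt_cochain_group n Y \<Gamma>\<^esub> \<omega>"
      using \<eta> by (auto simp: r_coset_def)
    have pb: "?p b \<in> ?BX" by (rule cochain_pullback_mt_coboundary[OF \<Gamma> f b(1)])
    have "?p \<eta> = ?p b \<otimes>\<^bsub>cochain_group n (mt_top X) \<Gamma>\<^esub> ?p \<omega>"
      using simplex_map_mem[OF f]
      by (auto simp: b(2) mt_cochain_group_simps cochain_group_simps cochain_pullback_def fun_eq_iff)
    then have "?BX #>\<^bsub>cochain_group n (mt_top X) \<Gamma>\<^esub> ?p \<eta> =
        (?BX #>\<^bsub>cochain_group n (mt_top X) \<Gamma>\<^esub> ?p b) #>\<^bsub>cochain_group n (mt_top X) \<Gamma>\<^esub> ?p \<omega>"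
      using pb p\<omega> BX.subset CX.coset_mult_assoc BX.mem_carrier by metis
    also have "?BX #>\<^bsub>cochain_group n (mt_top X) \<Gamma>\<^esub> ?p b = ?BX"
      using pb BX.mem_carrier BX.subgroup_axioms by (intro CX.coset_join2) auto
    finally show ?thesis by (simp add: rX)
  qed
  have "?BY #>\<^bsub>mt_cochain_group n Y \<Gamma>\<^esub> \<omega> \<noteq> {}"
    using subgroup.one_closed[OF subgroup_mt_coboundaries[OF \<Gamma>]] by (auto simp: r_coset_def)
  moreover have "?BY #>\<^bsub>mt_cochain_group n Y \<Gamma>\<^esub> \<omega> \<in> carrier (mt_cohomology n Y \<Gamma>)"
    using \<omega> by (auto simp: mt_cohomology_def carrier_FactGroup r_coset_def)
  ultimately show ?thesis
    using eq by (simp add: mt_cohomology_map_def)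
qed

end

theory Submission
  imports Defs
begin

text \<open>The classical prism operator, which sends a cochain \<open>\<omega>\<close> on \<open>Y\<close> to the alternating sum of the
  values of \<open>\<omega>\<close> on the simplices of the triangulated prism \<open>\<sigma> \<times> [0,1]\<close> pushed forward along the
  homotopy, is a cochain homotopy between the two pullbacks. It preserves measurability: applied
  fibrewise to a measurable singular simplex \<open>\<Delta>\<^sup>n \<times> T \<rightarrow> X\<close>, each prism simplex is again an MT-map
  \<open>\<Delta>\<^sup>n\<^sup>+\<^sup>1 \<times> T \<rightarrow> Y\<close>, because the prism coordinates are continuous, hence Borel, on \<open>\<Delta>\<^sup>n\<^sup>+\<^sup>1\<close>.\<close>

section \<open>Degeneracies\<close>

text \<open>The affine map merging the vertices \<open>i\<close> and \<open>Suc i\<close>, the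
  counterpart of \<open>simplical_face\<close>. Points are sequences on all of \<open>nat\<close>,
  so one formula serves every dimension.\<close>

definition simplical_degeneracy :: "nat \<Rightarrow> (nat \<Rightarrow> real) \<Rightarrow> nat \<Rightarrow> real" where
  "simplical_degeneracy i x =
     (\<lambda>k. if k < i then x k else if k = i then x i + x (Suc i) else x (Suc k))"

text \<open>Partial sums of coordinates are the heights in the prism. A face map inserts a zero at
  position \<open>k\<close>, which only shifts the upper index, and only if \<open>k < m\<close>;
  then \<open>m - 1\<close> is a true predecessor.\<close>

lemma sum_lessThan_simplical_face:
  fixes x :: "nat \<Rightarrow> real"
  shows "(\<Sum>j<m. simplical_face k x j) = (\<Sum>j<(if k < m then m - 1 else m). x j)"
proof (induction m)
  case (Suc m)
  show ?case
  proof (cases "k < m")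
    case True
    then obtain m' where "m = Suc m'" by (cases m) auto
    with True Suc show ?thesis by (simp add: simplical_face_def)
  next
    case False
    with Suc show ?thesis by (auto simp: simplical_face_def)
  qed
qed simp

lemma sum_lessThan_simplical_degeneracy:
  "(\<Sum>j<m. simplical_degeneracy i x j) = (\<Sum>j<(if m \<le> i then m else Suc m). x j)"
  by (induction m) (auto simp: simplical_degeneracy_def not_le less_Suc_eq le_Suc_eq)

text \<open>The cosimplicial identities. In the last two, one of the merged coordinates is the
  inserted zero.\<close>

lemma simplical_degeneracy_face:
  "k \<le> i \<Longrightarrow> simplical_degeneracy (Suc i) (simplical_face k x) = simplical_face k (simplical_degeneracy i x)"
  "i < k \<Longrightarrow> simplical_degeneracy i (simplical_face (Suc k) x) = simplical_face k (simplical_degeneracy i x)"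
  "simplical_degeneracy i (simplical_face i x) = x"
  "simplical_degeneracy i (simplical_face (Suc i) x) = x"
  by (auto simp: simplical_degeneracy_def simplical_face_def fun_eq_iff)

text \<open>Each nonnegative coordinate is bounded by the total sum 1. Summing over
  \<open>{..<Suc p}\<close> matches the partial sums above.\<close>

lemma standard_simplex_iff_nonneg:
  "x \<in> standard_simplex p \<longleftrightarrow> (\<forall>i. 0 \<le> x i) \<and> (\<forall>i>p. x i = 0) \<and> (\<Sum>i<Suc p. x i) = 1"
proof -
  have "x i \<le> 1" if "\<forall>i. 0 \<le> x i" "\<forall>i>p. x i = 0" "(\<Sum>i\<le>p. x i) = 1" for i
  proof (cases "i \<le> p")
    case True
    then show ?thesis using that member_le_sum[of i "{..p}" x] by auto
  next
    case False
    then show ?thesis using that by auto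
  qed
  then show ?thesis by (auto simp: standard_simplex_def lessThan_Suc_atMost)
qed

lemma simplical_degeneracy_in_standard_simplex:
  assumes "i \<le> n" "x \<in> standard_simplex (Suc n)"
  shows "simplical_degeneracy i x \<in> standard_simplex n"
proof -
  have "(\<Sum>j<Suc n. simplical_degeneracy i x j) = 1"
    using assms by (simp only: sum_lessThan_simplical_degeneracy standard_simplex_iff_nonneg) simp
  then show ?thesis
    using assms unfolding standard_simplex_iff_nonneg by (auto simp: simplical_degeneracy_def)
qed

section \<open>Continuity of the prism coordinates\<close>

lemma continuous_map_coordinate:
  "continuous_map (simplex_top n) euclideanreal (\<lambda>x. x k)"
  by (intro continuous_map_from_subtopology continuous_map_product_projection) simp

lemma continuous_map_simplical_degeneracy:
  assumes "i \<le> n"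
  shows "continuous_map (simplex_top (Suc n)) (simplex_top n) (simplical_degeneracy i)"
proof -
  have "continuous_map (simplex_top (Suc n)) euclideanreal (\<lambda>x. simplical_degeneracy i x k)" for k
    unfolding simplical_degeneracy_def
    by (cases k i rule: linorder_cases)
      (auto intro!: continuous_map_add continuous_map_coordinate)
  then show ?thesis
    using simplical_degeneracy_in_standard_simplex[OF assms]
    by (auto simp: continuous_map_in_subtopology continuous_map_componentwise)
qed

lemma continuous_map_partial_sum:
  "continuous_map (simplex_top n) (top_of_set {0..1}) (\<lambda>x. \<Sum>j<m. x j)"
proof -
  have "(\<Sum>j<m. x j) \<in> {0..1}" if "x \<in> standard_simplex n" for x
  proof -
    \<comment> \<open>\<open>m\<close> may exceed the dimension; coordinates with index above
      \<open>n\<close> vanish, so this is part of the total sum 1.\<close>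
    have "(\<Sum>j<m. x j) = (\<Sum>j\<in>{..<m} \<inter> {..<Suc n}. x j)"
      using that by (intro sum.mono_neutral_right) (auto simp: standard_simplex_iff_nonneg not_less_eq)
    also have "\<dots> \<le> (\<Sum>j<Suc n. x j)"
      using that by (intro sum_mono2) (auto simp: standard_simplex_iff_nonneg)
    finally show ?thesis using that by (auto simp: standard_simplex_iff_nonneg intro: sum_nonneg)
  qed
  then show ?thesis
    unfolding continuous_map_in_subtopology
    by (auto intro!: continuous_map_sum continuous_map_coordinate)
qed

section \<open>The prism over a singular simplex\<close>

text \<open>The \<open>i\<close>-th simplex of the triangulated prism has the vertices \<open>0, \<dots>, i\<close> at height 1 and
  \<open>i, \<dots>, n\<close> at height 0, so the point with barycentric coordinates \<open>x\<close> lies over the \<open>i\<close>-th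
  degeneracy of \<open>x\<close> at height \<open>x 0 + \<dots> + x i\<close>.\<close>

definition prism_simplex ::
    "nat \<Rightarrow> ('a \<times> real \<Rightarrow> 'b) \<Rightarrow> nat \<Rightarrow> ((nat \<Rightarrow> real) \<Rightarrow> 'a) \<Rightarrow> (nat \<Rightarrow> real) \<Rightarrow> 'b" where
  "prism_simplex n H i \<sigma> =
     (\<lambda>x\<in>standard_simplex (Suc n). H (\<sigma> (simplical_degeneracy i x), \<Sum>j<Suc i. x j))"

text \<open>The walls \<open>0 < i < Suc n\<close> are the faces shared by consecutive prism simplices, which cancel in
  the boundary; \<open>i = 0\<close> and \<open>i = Suc n\<close> are the bottom and the top of the prism.\<close>

definition prism_wall ::
    "nat \<Rightarrow> ('a \<times> real \<Rightarrow> 'b) \<Rightarrow> nat \<Rightarrow> ((nat \<Rightarrow> real) \<Rightarrow> 'a) \<Rightarrow> (nat \<Rightarrow> real) \<Rightarrow> 'b" where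
  "prism_wall n H i \<sigma> = (\<lambda>x\<in>standard_simplex n. H (\<sigma> x, \<Sum>j<i. x j))"

lemma singular_simplex_prism_simplex:
  assumes H: "continuous_map (prod_topology S (top_of_set {0..1})) S' H"
    and \<sigma>: "singular_simplex n S \<sigma>" and i: "i \<le> n"
  shows "singular_simplex (Suc n) S' (prism_simplex n H i \<sigma>)"
proof -
  have "continuous_map (simplex_top n) S \<sigma>" using \<sigma> by (simp add: singular_simplex_def)
  then have "continuous_map (simplex_top (Suc n)) S (\<lambda>x. \<sigma> (simplical_degeneracy i x))"
    using continuous_map_compose[OF continuous_map_simplical_degeneracy[OF i]] by (simp add: o_def)
  then have "continuous_map (simplex_top (Suc n)) (prod_topology S (top_of_set {0..1}))
      (\<lambda>x. (\<sigma> (simplical_degeneracy i x), \<Sum>j<Suc i. x j))"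
    using continuous_map_partial_sum by (intro continuous_map_pairedI)
  from continuous_map_compose[OF this H]
  have "continuous_map (simplex_top (Suc n)) S' (prism_simplex n H i \<sigma>)"
    by (rule continuous_map_eq) (simp add: prism_simplex_def)
  then show ?thesis by (simp add: singular_simplex_def prism_simplex_def)
qed

text \<open>If the deleted vertex is not a copy of the doubled one, its partner at the other height
  is absent too, so what remains is a prism simplex over a face of \<open>\<sigma>\<close>. Deleting
  the upper or lower copy of vertex \<open>i\<close> leaves wall \<open>i\<close> or
  \<open>Suc i\<close>.\<close>

lemma singular_face_prism_simplex:
  shows "k \<le> i \<Longrightarrow> i < n \<Longrightarrow>
      singular_face (Suc n) k (prism_simplex n H (Suc i) \<sigma>) = prism_simplex (n - 1) H i (singular_face n k \<sigma>)"
    and "i < k \<Longrightarrow> k \<le> n \<Longrightarrow>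
      singular_face (Suc n) (Suc k) (prism_simplex n H i \<sigma>) = prism_simplex (n - 1) H i (singular_face n k \<sigma>)"
    and "i \<le> n \<Longrightarrow> singular_face (Suc n) i (prism_simplex n H i \<sigma>) = prism_wall n H i \<sigma>"
    and "i \<le> n \<Longrightarrow> singular_face (Suc n) (Suc i) (prism_simplex n H i \<sigma>) = prism_wall n H (Suc i) \<sigma>"
proof -
  have face: "singular_face (Suc n) k (prism_simplex n H i \<sigma>) =
      (\<lambda>x\<in>standard_simplex n. H (\<sigma> (simplical_degeneracy i (simplical_face k x)),
         \<Sum>j<(if k < Suc i then i else Suc i). x j))" if "k \<le> Suc n" for k i
    using simplical_face_in_standard_simplex[of "Suc n" k] that
    by (auto simp: singular_face_def prism_simplex_def fun_eq_iff
        sum_lessThan_simplical_face simp del: sum.lessThan_Suc)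
  \<comment> \<open>Here \<open>i < n\<close> forces \<open>n > 0\<close>, so
    \<open>Suc (n - 1)\<close> is \<open>n\<close> and the degeneracy lands in the domain of the
    face of \<open>\<sigma>\<close>.\<close>
  have prism: "prism_simplex (n - 1) H i (singular_face n k \<sigma>) =
      (\<lambda>x\<in>standard_simplex n. H (\<sigma> (simplical_face k (simplical_degeneracy i x)), \<Sum>j<Suc i. x j))"
    if "i < n" for k i
    using simplical_degeneracy_in_standard_simplex[of i "n - 1"] that
    by (auto simp: singular_face_def prism_simplex_def fun_eq_iff)
  show "singular_face (Suc n) k (prism_simplex n H (Suc i) \<sigma>) = prism_simplex (n - 1) H i (singular_face n k \<sigma>)"
    if "k \<le> i" "i < n"
    using that by (simp only: face prism simplical_degeneracy_face) simp
  show "singular_face (Suc n) (Suc k) (prism_simplex n H i \<sigma>) = prism_simplex (n - 1) H i (singular_face n k \<sigma>)"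
    if "i < k" "k \<le> n"
    using that by (simp only: face prism simplical_degeneracy_face) simp
  show "singular_face (Suc n) i (prism_simplex n H i \<sigma>) = prism_wall n H i \<sigma>" if "i \<le> n"
    using that by (simp add: face prism_wall_def simplical_degeneracy_face)
  show "singular_face (Suc n) (Suc i) (prism_simplex n H i \<sigma>) = prism_wall n H (Suc i) \<sigma>" if "i \<le> n"
    using that by (simp add: face prism_wall_def simplical_degeneracy_face)
qed

lemma prism_wall_0: "prism_wall n H 0 \<sigma> = simplex_map n (\<lambda>x. H (x, 0)) \<sigma>"
  by (auto simp: prism_wall_def simplex_map_def)

text \<open>The height is now the full coordinate sum, which is 1 on the simplex.\<close>

lemma prism_wall_Suc: "prism_wall n H (Suc n) \<sigma> = simplex_map n (\<lambda>x. H (x, 1)) \<sigma>"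
  by (auto simp: prism_wall_def simplex_map_def fun_eq_iff standard_simplex_iff_nonneg
      simp del: sum.lessThan_Suc)

text \<open>The combinatorial core: \<open>a k i\<close> stands for face \<open>k\<close> of prism
  simplex \<open>i\<close>, \<open>b k i\<close> for prism simplex \<open>i\<close> over face
  \<open>k\<close>, and \<open>e i\<close> for wall \<open>i\<close>. Off the diagonal,
  \<open>a\<close> and \<open>b\<close> cancel by sign; the diagonal telescopes.\<close>

lemma prism_alternating_sum:
  fixes a b :: "nat \<Rightarrow> nat \<Rightarrow> 'a \<Rightarrow>\<^sub>0 int"
  assumes below: "\<And>k i. k \<le> i \<Longrightarrow> i < n \<Longrightarrow> a k (Suc i) = b k i"
    and above: "\<And>k i. i < k \<Longrightarrow> k \<le> n \<Longrightarrow> a (Suc k) i = b k i"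
    and walls: "\<And>i. i \<le> n \<Longrightarrow> a i i = e i" "\<And>i. i \<le> n \<Longrightarrow> a (Suc i) i = e (Suc i)"
  shows "(\<Sum>i\<le>n. frag_cmul ((-1) ^ i) (\<Sum>k\<le>Suc n. frag_cmul ((-1) ^ k) (a k i))) +
      (\<Sum>k\<le>n. frag_cmul ((-1) ^ k) (\<Sum>i<n. frag_cmul ((-1) ^ i) (b k i))) = e 0 - e (Suc n)"
proof -
  let ?c = "\<lambda>i k. frag_cmul ((-1) ^ (i + k)) (b k i)"
  \<comment> \<open>The two middle terms are the walls; the later faces are indexed by
    \<open>Suc k\<close> to fit \<open>above\<close>, which costs a sign.\<close>
  have split: "(\<Sum>k\<le>Suc n. F k) = (\<Sum>k<i. F k) + F i + F (Suc i) + (\<Sum>k\<in>{i<..n}. F (Suc k))"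
    if "i \<le> n" for F :: "nat \<Rightarrow> 'a \<Rightarrow>\<^sub>0 int" and i
  proof -
    have "{..Suc n} = {..<i} \<union> ({i, Suc i} \<union> Suc ` {i<..n})"
      using that by (auto simp: image_iff) (metis Suc_lessI greaterThanAtMost_iff Suc_le_mono not_less_iff_gr_or_eq Suc_less_eq less_imp_Suc_add)
    moreover have "(\<Sum>k\<in>{..<i} \<union> ({i, Suc i} \<union> Suc ` {i<..n}). F k) =
        (\<Sum>k<i. F k) + (\<Sum>k\<in>{i, Suc i} \<union> Suc ` {i<..n}. F k)"
      by (intro sum.union_disjoint) auto
    moreover have "(\<Sum>k\<in>{i, Suc i} \<union> Suc ` {i<..n}. F k) = F i + F (Suc i) + (\<Sum>k\<in>Suc ` {i<..n}. F k)"
      by (subst sum.union_disjoint) auto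
    ultimately show ?thesis by (simp add: sum.reindex add.assoc)
  qed
  have inner: "frag_cmul ((-1) ^ i) (\<Sum>k\<le>Suc n. frag_cmul ((-1) ^ k) (a k i)) =
      (\<Sum>k<i. frag_cmul ((-1) ^ (i + k)) (a k i)) + (e i - e (Suc i)) - (\<Sum>k\<in>{i<..n}. ?c i k)"
    if i: "i \<le> n" for i
  proof -
    have "(-1::int) ^ (i + i) = 1" by (simp flip: mult_2)
    then show ?thesis
      unfolding split[OF i] using above walls i
      by (simp add: frag_cmul_sum frag_cmul_distrib2 power_add flip: sum_negf)
  qed
  \<comment> \<open>The term for \<open>i = 0\<close> is empty, so \<open>i\<close> can be shifted
    by one; the shift reverses the sign.\<close>
  have "(\<Sum>i\<le>n. \<Sum>k<i. frag_cmul ((-1) ^ (i + k)) (a k i)) =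
      (\<Sum>i<n. \<Sum>k\<le>i. frag_cmul ((-1) ^ (Suc i + k)) (a k (Suc i)))"
    by (subst sum.atMost_shift) (simp add: lessThan_Suc_atMost del: sum.atMost_Suc sum.lessThan_Suc)
  also have "\<dots> = - (\<Sum>i<n. \<Sum>k\<le>i. ?c i k)"
    by (simp add: below flip: sum_negf)
  finally have low: "(\<Sum>i\<le>n. \<Sum>k<i. frag_cmul ((-1) ^ (i + k)) (a k i)) = - (\<Sum>i<n. \<Sum>k\<le>i. ?c i k)" .
  \<comment> \<open>The term for \<open>i = n\<close> is empty.\<close>
  have high: "(\<Sum>i\<le>n. \<Sum>k\<in>{i<..n}. ?c i k) = (\<Sum>i<n. \<Sum>k\<in>{i<..n}. ?c i k)"
    unfolding lessThan_Suc_atMost[symmetric] sum.lessThan_Suc by simp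
  have diag: "(\<Sum>i\<le>n. e i) - (\<Sum>i\<le>n. e (Suc i)) = e 0 - e (Suc n)"
    using sum_telescope[of e n] by (simp only: sum_subtractf)
  have "(\<Sum>k\<le>i. ?c i k) + (\<Sum>k\<in>{i<..n}. ?c i k) = (\<Sum>k\<le>n. ?c i k)" if "i < n" for i
    using that by (subst sum.union_disjoint[symmetric]) (auto intro: sum.cong)
  then have "(\<Sum>i<n. \<Sum>k\<le>i. ?c i k) + (\<Sum>i<n. \<Sum>k\<in>{i<..n}. ?c i k) = (\<Sum>i<n. \<Sum>k\<le>n. ?c i k)"
    by (simp flip: sum.distrib)
  also have "\<dots> = (\<Sum>k\<le>n. frag_cmul ((-1) ^ k) (\<Sum>i<n. frag_cmul ((-1) ^ i) (b k i)))"
    by (subst sum.swap) (simp add: frag_cmul_sum power_add mult.commute)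
  finally have "(\<Sum>k\<le>n. frag_cmul ((-1) ^ k) (\<Sum>i<n. frag_cmul ((-1) ^ i) (b k i))) =
      (\<Sum>i<n. \<Sum>k\<le>i. ?c i k) + (\<Sum>i<n. \<Sum>k\<in>{i<..n}. ?c i k)" by simp
  then show ?thesis
    by (simp add: inner sum.distrib sum_subtractf low high diag del: sum.atMost_Suc)
qed

section \<open>The prism operator on cochains\<close>

text \<open>\<open>n\<close> is the degree of the result, so \<open>\<omega>\<close> has degree
  \<open>Suc n\<close>. The restriction is there because cochains are extensional functions.\<close>

definition prism_cochain ::
    "nat \<Rightarrow> 'a topology \<Rightarrow> 'g sigma_ring \<Rightarrow> ('a \<times> real \<Rightarrow> 'b) \<Rightarrow>
      (((nat \<Rightarrow> real) \<Rightarrow> 'b) \<Rightarrow> 'g) \<Rightarrow> ((nat \<Rightarrow> real) \<Rightarrow> 'a) \<Rightarrow> 'g" where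
  "prism_cochain n S \<Gamma> H \<omega> =
     (\<lambda>\<sigma>\<in>singular_simplex_set n S.
        \<Oplus>\<^bsub>\<Gamma>\<^esub>i\<in>{..n}. add_pow \<Gamma> ((-1::int) ^ i) (\<omega> (prism_simplex n H i \<sigma>)))"

text \<open>Evaluation at \<open>\<omega>\<close> transports identities between formal sums of simplices to the
  coefficients, where only the carrier-based \<open>\<Oplus>\<close> is available.\<close>

lemma (in abelian_group) free_abelian_evaluation:
  fixes \<omega> :: "'c \<Rightarrow> 'a"
  assumes "\<omega> \<in> A \<rightarrow> carrier G"
  obtains h :: "('c \<Rightarrow>\<^sub>0 int) \<Rightarrow> 'a"
  where "\<And>c d. h (c + d) = h c \<oplus> h d"
    "\<And>(B :: nat set) z c w. finite B \<Longrightarrow> (\<And>i. i \<in> B \<Longrightarrow> h (c i) = w i) \<Longrightarrow>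
      h (\<Sum>i\<in>B. frag_cmul (z i) (c i)) = (\<Oplus>i\<in>B. add_pow G (z i) (w i))"
    "\<And>s. s \<in> A \<Longrightarrow> h (frag_of s) = \<omega> s"
proof -
  \<comment> \<open>Extending by zero makes \<open>h\<close> total on formal sums, hence additive
    without side conditions.\<close>
  define \<omega>' where "\<omega>' s = (if s \<in> A then \<omega> s else \<zero>)" for s
  have "\<omega>' ` UNIV \<subseteq> carrier (add_monoid G)" using assms by (auto simp: \<omega>'_def)
  then obtain h where h: "h \<in> hom (free_Abelian_group UNIV) (add_monoid G)"
      "\<And>s. s \<in> UNIV \<Longrightarrow> h (frag_of s) = \<omega>' s"
    using comm_group.free_Abelian_group_universal[OF a_comm_group, of \<omega>' UNIV] by metis
  have closed: "h c \<in> carrier G" for c using h(1) by (auto simp: hom_def Pi_def)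
  have add: "h (c + d) = h c \<oplus> h d" for c d
    using h(1) by (auto simp: hom_def)
  have cmul: "h (frag_cmul z c) = add_pow G z (h c)" for z c
    using hom_int_pow[OF h(1) _ group_free_Abelian_group a_group, of c z] by (simp add: add_pow_def)
  have zero: "h 0 = \<zero>"
    using hom_one[OF h(1) group_free_Abelian_group a_group] by simp
  \<comment> \<open>Prescribing the values \<open>w i\<close> lets nested sums be evaluated from the
    inside out.\<close>
  have "h (\<Sum>i\<in>B. frag_cmul (z i) (c i)) = (\<Oplus>i\<in>B. add_pow G (z i) (w i))"
    if "finite B" "\<And>i. i \<in> B \<Longrightarrow> h (c i) = w i" for B :: "nat set" and z c w
    using that
  proof (induction B)
    case (insert i B)
    have "w j \<in> carrier G" if "j \<in> insert i B" for j
      using insert.prems[OF that] closed[of "c j"] by simp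
    then show ?case
      using insert by (simp add: add cmul add.int_pow_closed Pi_iff)
  qed (simp add: zero)
  then show ?thesis
  proof (rule that[OF add])
    show "h (frag_of s) = \<omega> s" if "s \<in> A" for s
      using that by (simp add: h(2) \<omega>'_def)
  qed
qed

text \<open>The chain-level prism identity evaluated at \<open>\<omega>\<close>. The top term stands
  on the left so that only addition occurs; in degree 0 there is no prism cochain of lower
  degree.\<close>

lemma prism_cochain_homotopy:
  assumes \<Gamma>: "abelian_group \<Gamma>"
    and H: "continuous_map (prod_topology S (top_of_set {0..1})) S' H"
    and \<omega>: "\<omega> \<in> carrier (cochain_group n S' \<Gamma>)" and \<sigma>: "singular_simplex n S \<sigma>"
  shows "prism_cochain n S \<Gamma> H (coboundary n S' \<Gamma> \<omega>) \<sigma> \<oplus>\<^bsub>\<Gamma>\<^esub>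
      (case n of 0 \<Rightarrow> \<zero>\<^bsub>\<Gamma>\<^esub> | Suc m \<Rightarrow> coboundary m S \<Gamma> (prism_cochain m S \<Gamma> H \<omega>) \<sigma>) \<oplus>\<^bsub>\<Gamma>\<^esub>
      \<omega> (simplex_map n (\<lambda>x. H (x, 1)) \<sigma>) = \<omega> (simplex_map n (\<lambda>x. H (x, 0)) \<sigma>)"
proof -
  interpret abelian_group \<Gamma> by fact
  have "\<omega> \<in> singular_simplex_set n S' \<rightarrow> carrier \<Gamma>"
    using \<omega> by (auto simp: cochain_group_simps)
  then obtain h where h: "\<And>c d. h (c + d) = h c \<oplus>\<^bsub>\<Gamma>\<^esub> h d"
    and h_sum: "\<And>(B :: nat set) z c w. finite B \<Longrightarrow> (\<And>i. i \<in> B \<Longrightarrow> h (c i) = w i) \<Longrightarrow>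
      h (\<Sum>i\<in>B. frag_cmul (z i) (c i)) = (\<Oplus>\<^bsub>\<Gamma>\<^esub>i\<in>B. add_pow \<Gamma> (z i) (w i))"
    and h_of: "\<And>s. s \<in> singular_simplex_set n S' \<Longrightarrow> h (frag_of s) = \<omega> s"
    using free_abelian_evaluation[of \<omega> "singular_simplex_set n S'"] by blast
  let ?D = "\<lambda>i. prism_simplex n H i \<sigma>"
  let ?a = "\<lambda>k i. frag_of (singular_face (Suc n) k (?D i))"
  let ?b = "\<lambda>k i. frag_of (prism_simplex (n - 1) H i (singular_face n k \<sigma>))"
  let ?e = "\<lambda>i. frag_of (prism_wall n H i \<sigma>)"
  let ?P = "\<Sum>i\<le>n. frag_cmul ((-1) ^ i) (\<Sum>k\<le>Suc n. frag_cmul ((-1) ^ k) (?a k i))"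
  let ?Q = "\<Sum>k\<le>n. frag_cmul ((-1) ^ k) (\<Sum>i<n. frag_cmul ((-1) ^ i) (?b k i))"
  have D: "singular_simplex (Suc n) S' (?D i)" if "i \<le> n" for i
    using singular_simplex_prism_simplex[OF H \<sigma> that] .
  have face: "singular_simplex n S' (singular_face (Suc n) k (?D i))" if "i \<le> n" "k \<le> Suc n" for i k
    using singular_face_mem[of "?D i" n S' k] D that by simp
  have P: "h ?P = prism_cochain n S \<Gamma> H (coboundary n S' \<Gamma> \<omega>) \<sigma>"
  proof -
    have "h (\<Sum>k\<le>Suc n. frag_cmul ((-1) ^ k) (?a k i)) = coboundary n S' \<Gamma> \<omega> (?D i)" if "i \<le> n" for i
    proof -
      have "coboundary n S' \<Gamma> \<omega> (?D i) =
          (\<Oplus>\<^bsub>\<Gamma>\<^esub>k\<in>{..Suc n}. add_pow \<Gamma> ((-1::int) ^ k) (\<omega> (singular_face (Suc n) k (?D i))))"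
        using D[OF that] unfolding coboundary_def by (intro restrict_apply') simp
      then show ?thesis using face[OF that] by (simp only:) (rule h_sum; simp add: h_of)
    qed
    then have "h ?P = (\<Oplus>\<^bsub>\<Gamma>\<^esub>i\<in>{..n}. add_pow \<Gamma> ((-1::int) ^ i) (coboundary n S' \<Gamma> \<omega> (?D i)))"
      by (intro h_sum) simp_all
    then show ?thesis using \<sigma> by (simp add: prism_cochain_def)
  qed
  have Q: "h ?Q = (case n of 0 \<Rightarrow> \<zero>\<^bsub>\<Gamma>\<^esub> | Suc m \<Rightarrow> coboundary m S \<Gamma> (prism_cochain m S \<Gamma> H \<omega>) \<sigma>)"
  proof (cases n)
    case 0
    \<comment> \<open>The inner sums over \<open>{..<0}\<close> are empty; the empty instance of
      \<open>h_sum\<close> gives \<open>h 0\<close>.\<close>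
    then show ?thesis using h_sum[of "{}" undefined undefined undefined] by simp
  next
    case (Suc m)
    have \<sigma>k: "singular_simplex m S (singular_face n k \<sigma>)" if "k \<le> n" for k
      using singular_face_mem[of \<sigma> m S k] \<sigma> that Suc by simp
    have "h (\<Sum>i<n. frag_cmul ((-1) ^ i) (?b k i)) = prism_cochain m S \<Gamma> H \<omega> (singular_face n k \<sigma>)"
      if "k \<le> n" for k
    proof -
      have "h (\<Sum>i<n. frag_cmul ((-1) ^ i) (?b k i)) =
          (\<Oplus>\<^bsub>\<Gamma>\<^esub>i\<in>{..<n}. add_pow \<Gamma> ((-1::int) ^ i) (\<omega> (prism_simplex m H i (singular_face n k \<sigma>))))"
        using singular_simplex_prism_simplex[OF H \<sigma>k[OF that]] Suc
        by (intro h_sum) (auto simp: h_of)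
      then show ?thesis
        using \<sigma>k[OF that] by (simp add: prism_cochain_def Suc lessThan_Suc_atMost)
    qed
    then have "h ?Q = (\<Oplus>\<^bsub>\<Gamma>\<^esub>k\<in>{..n}. add_pow \<Gamma> ((-1::int) ^ k) (prism_cochain m S \<Gamma> H \<omega> (singular_face n k \<sigma>)))"
      by (intro h_sum) simp_all
    also have "\<dots> = coboundary m S \<Gamma> (prism_cochain m S \<Gamma> H \<omega>) \<sigma>"
      unfolding coboundary_def Suc by (rule restrict_apply'[symmetric]) (use \<sigma> Suc in simp)
    finally show ?thesis by (simp add: Suc)
  qed
  \<comment> \<open>The outer walls are face 0 of the first and face \<open>Suc n\<close> of the
    last prism simplex, hence singular simplices, where \<open>h\<close> agrees with
    \<open>\<omega>\<close>.\<close>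
  have e: "h (?e 0) = \<omega> (prism_wall n H 0 \<sigma>)" "h (?e (Suc n)) = \<omega> (prism_wall n H (Suc n) \<sigma>)"
    using face[of 0 0] face[of n "Suc n"] singular_face_prism_simplex(3)[of 0 n H \<sigma>]
      singular_face_prism_simplex(4)[of n n H \<sigma>] h_of by auto
  have "?P + ?Q = ?e 0 - ?e (Suc n)"
    by (rule prism_alternating_sum) (simp_all add: singular_face_prism_simplex)
  then have "h (?P + ?Q + ?e (Suc n)) = h (?e 0)" by simp
  then show ?thesis
    by (simp only: h P Q e flip: prism_wall_0[of n H \<sigma>] prism_wall_Suc[of n H \<sigma>])
qed

section \<open>Measurability of the prism operator\<close>

lemma measurable_finsum:
  assumes \<Gamma>: "standard_group \<Gamma> \<or> standard_ring \<Gamma>"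
    and "finite A" and F: "\<And>i. i \<in> A \<Longrightarrow> F i \<in> T \<rightarrow>\<^sub>M coeff_sigma \<Gamma>"
  shows "(\<lambda>t. \<Oplus>\<^bsub>\<Gamma>\<^esub>i\<in>A. F i t) \<in> T \<rightarrow>\<^sub>M coeff_sigma \<Gamma>"
proof -
  note G = standard_group_or_ringD[OF \<Gamma>]
  interpret abelian_group \<Gamma> by (rule G)
  show ?thesis
    using assms(2) F
  proof (induction A)
    case empty
    then show ?case using G(2) by simp
  next
    case (insert i A)
    then have "(\<lambda>t. (F i t, \<Oplus>\<^bsub>\<Gamma>\<^esub>i\<in>A. F i t)) \<in> T \<rightarrow>\<^sub>M coeff_sigma \<Gamma> \<Otimes>\<^sub>M coeff_sigma \<Gamma>"
      by (intro measurable_Pair) auto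
    from measurable_compose[OF this G(3)] show ?case
    proof (rule measurable_cong[THEN iffD1, rotated])
      fix t assume "t \<in> space T"
      \<comment> \<open>Splitting a summand off \<open>\<Oplus>\<close> requires all values to lie
        in the carrier.\<close>
      then have "F j t \<in> carrier \<Gamma>" if "j \<in> insert i A" for j
        using measurable_space[OF insert.prems[OF that]] G(2) by simp
      then show "(case (F i t, \<Oplus>\<^bsub>\<Gamma>\<^esub>i\<in>A. F i t) of (a, b) \<Rightarrow> a \<oplus>\<^bsub>\<Gamma>\<^esub> b) = (\<Oplus>\<^bsub>\<Gamma>\<^esub>i\<in>insert i A. F i t)"
        using insert.hyps by simp
    qed
  qed
qed

text \<open>The multiple is by 1 or -1, so it is the identity or the measurable inverse map.\<close>

lemma measurable_add_pow_sign:
  assumes \<Gamma>: "standard_group \<Gamma> \<or> standard_ring \<Gamma>" and F: "F \<in> T \<rightarrow>\<^sub>M coeff_sigma \<Gamma>"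
  shows "(\<lambda>t. add_pow \<Gamma> ((-1::int) ^ i) (F t)) \<in> T \<rightarrow>\<^sub>M coeff_sigma \<Gamma>"
proof -
  note G = standard_group_or_ringD[OF \<Gamma>]
  interpret abelian_group \<Gamma> by (rule G)
  have F': "F t \<in> carrier \<Gamma>" if "t \<in> space T" for t
    using measurable_space[OF F that] G(2) by simp
  show ?thesis
  proof (cases "even i")
    case True
    then have "(\<lambda>t. F t) \<in> T \<rightarrow>\<^sub>M coeff_sigma \<Gamma> \<longleftrightarrow> ?thesis"
      by (intro measurable_cong) (simp add: F' add.int_pow_1)
    with F show ?thesis by simp
  next
    case False
    then have "(\<lambda>t. \<ominus>\<^bsub>\<Gamma>\<^esub> F t) \<in> T \<rightarrow>\<^sub>M coeff_sigma \<Gamma> \<longleftrightarrow> ?thesis"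
      using add.int_pow_neg[of _ 1] by (intro measurable_cong) (simp add: F' add.int_pow_1 a_inv_def)
    with measurable_compose[OF F G(4)] show ?thesis by simp
  qed
qed

text \<open>The parameter \<open>t\<close> is carried along unchanged. Measurability and continuity
  are checked in parallel, since \<open>mt_sigma\<close> need not be the Borel algebra of
  \<open>mt_top\<close>.\<close>

lemma measurable_simplex_prism:
  assumes H: "mt_map (mt_prod X (mt_borel (top_of_set {0..1::real}))) Y H"
    and \<sigma>: "measurable_simplex n X T \<sigma>" and i: "i \<le> n"
  shows "measurable_simplex (Suc n) Y T
    (\<lambda>(x, t). H (\<sigma> (simplical_degeneracy i x, t), \<Sum>j<Suc i. x j))"
proof -
  let ?D = "discrete_topology (space T)" and ?I = "top_of_set {0..1::real}"
  let ?p = "\<lambda>z. (simplical_degeneracy i (fst z), snd z)"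
  have H1: "H \<in> mt_sigma X \<Otimes>\<^sub>M borel_of ?I \<rightarrow>\<^sub>M mt_sigma Y"
    and H2: "continuous_map (prod_topology (mt_top X) ?I) (mt_top Y) H"
    using H by (auto simp: mt_map_def mt_prod_def mt_borel_def)
  have T: "standard_borel T" and \<sigma>1: "\<sigma> \<in> borel_of (simplex_top n) \<Otimes>\<^sub>M T \<rightarrow>\<^sub>M mt_sigma X"
    and \<sigma>2: "continuous_map (prod_topology (simplex_top n) ?D) (mt_top X) \<sigma>"
    using \<sigma> by (auto simp: measurable_simplex_def mt_map_def mt_prod_def mt_borel_def mt_discrete_def)
  note d = continuous_map_simplical_degeneracy[OF i]
  note s = continuous_map_partial_sum[of "Suc n" "Suc i"]
  have "?p \<in> borel_of (simplex_top (Suc n)) \<Otimes>\<^sub>M T \<rightarrow>\<^sub>M borel_of (simplex_top n) \<Otimes>\<^sub>M T"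
    by (intro measurable_Pair measurable_compose[OF measurable_fst borel_of_continuous_map[OF d]]
        measurable_snd)
  from measurable_compose[OF this \<sigma>1]
  have "(\<lambda>z. (\<sigma> (?p z), \<Sum>j<Suc i. fst z j)) \<in>
      borel_of (simplex_top (Suc n)) \<Otimes>\<^sub>M T \<rightarrow>\<^sub>M mt_sigma X \<Otimes>\<^sub>M borel_of ?I"
    by (intro measurable_Pair measurable_compose[OF measurable_fst borel_of_continuous_map[OF s]])
  from measurable_compose[OF this H1]
  have 1: "(\<lambda>z. H (\<sigma> (?p z), \<Sum>j<Suc i. fst z j)) \<in> borel_of (simplex_top (Suc n)) \<Otimes>\<^sub>M T \<rightarrow>\<^sub>M mt_sigma Y" .
  have "continuous_map (prod_topology (simplex_top (Suc n)) ?D) (prod_topology (simplex_top n) ?D) ?p"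
    using continuous_map_compose[OF continuous_map_fst d]
    by (intro continuous_map_pairedI continuous_map_snd) (simp add: o_def)
  from continuous_map_compose[OF this \<sigma>2]
  have "continuous_map (prod_topology (simplex_top (Suc n)) ?D) (prod_topology (mt_top X) ?I)
      (\<lambda>z. (\<sigma> (?p z), \<Sum>j<Suc i. fst z j))"
    using continuous_map_compose[OF continuous_map_fst s]
    by (intro continuous_map_pairedI) (simp_all add: o_def)
  from continuous_map_compose[OF this H2]
  have 2: "continuous_map (prod_topology (simplex_top (Suc n)) ?D) (mt_top Y)
      (\<lambda>z. H (\<sigma> (?p z), \<Sum>j<Suc i. fst z j))" by (simp add: o_def)
  have "(\<lambda>(x, t). H (\<sigma> (simplical_degeneracy i x, t), \<Sum>j<Suc i. x j)) =
      (\<lambda>z. H (\<sigma> (?p z), \<Sum>j<Suc i. fst z j))" by auto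
  with T 1 2 show ?thesis
    by (simp only: measurable_simplex_def mt_map_def mt_prod_def mt_borel_def mt_discrete_def
        mt_struct.simps simp_thms)
qed

lemma prism_cochain_mt_cochain:
  assumes \<Gamma>: "standard_group \<Gamma> \<or> standard_ring \<Gamma>"
    and H: "mt_map (mt_prod X (mt_borel (top_of_set {0..1::real}))) Y H"
    and \<omega>: "\<omega> \<in> carrier (mt_cochain_group (Suc n) Y \<Gamma>)"
  shows "prism_cochain n (mt_top X) \<Gamma> H \<omega> \<in> carrier (mt_cochain_group n X \<Gamma>)"
proof -
  interpret abelian_group \<Gamma> by (rule standard_group_or_ringD[OF \<Gamma>])
  have H2: "continuous_map (prod_topology (mt_top X) (top_of_set {0..1})) (mt_top Y) H"
    using H by (simp add: mt_map_def mt_prod_def mt_borel_def)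
  have "measurable_cochain n X \<Gamma> (prism_cochain n (mt_top X) \<Gamma> H \<omega>)"
    unfolding measurable_cochain_def
  proof (intro allI impI)
    fix T :: "real measure" and \<sigma> assume \<sigma>: "measurable_simplex n X T \<sigma>"
    let ?s = "\<lambda>t. \<lambda>x\<in>standard_simplex n. \<sigma> (x, t)"
    have "(\<lambda>t. \<omega> (prism_simplex n H i (?s t))) \<in> T \<rightarrow>\<^sub>M coeff_sigma \<Gamma>" if i: "i \<le> n" for i
    proof -
      \<comment> \<open>The prism simplex over a slice is a slice of the prism family, so
        measurability of \<open>\<omega>\<close> applies.\<close>
      have "prism_simplex n H i (?s t) = (\<lambda>x\<in>standard_simplex (Suc n).
          (\<lambda>(x, t). H (\<sigma> (simplical_degeneracy i x, t), \<Sum>j<Suc i. x j)) (x, t))" for t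
        using simplical_degeneracy_in_standard_simplex[OF i] by (auto simp: prism_simplex_def fun_eq_iff)
      moreover have "measurable_cochain (Suc n) Y \<Gamma> \<omega>" using \<omega> by (simp add: mt_cochain_group_simps)
      ultimately show ?thesis
        using measurable_cochain_any[OF _ measurable_simplex_prism[OF H \<sigma> i]] by (simp only:)
    qed
    then have "(\<lambda>t. \<Oplus>\<^bsub>\<Gamma>\<^esub>i\<in>{..n}. add_pow \<Gamma> ((-1::int) ^ i) (\<omega> (prism_simplex n H i (?s t))))
        \<in> T \<rightarrow>\<^sub>M coeff_sigma \<Gamma>"
      by (intro measurable_finsum[OF \<Gamma>] measurable_add_pow_sign[OF \<Gamma>]) auto
    then show "(\<lambda>t. prism_cochain n (mt_top X) \<Gamma> H \<omega> (?s t)) \<in> T \<rightarrow>\<^sub>M coeff_sigma \<Gamma>"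
      by (rule measurable_cong[THEN iffD1, rotated])
        (simp add: prism_cochain_def singular_simplex_slice[OF \<sigma>])
  qed
  moreover have "\<omega> (prism_simplex n H i \<sigma>) \<in> carrier \<Gamma>" if "singular_simplex n (mt_top X) \<sigma>" "i \<le> n" for \<sigma> i
    using \<omega> singular_simplex_prism_simplex[OF H2 that] by (auto simp: mt_cochain_group_simps)
  ultimately show ?thesis
    by (auto simp: mt_cochain_group_simps prism_cochain_def intro!: finsum_closed add.int_pow_closed)
qed

section \<open>Homotopy invariance\<close>

text \<open>Each end is \<open>H\<close> composed with the MT-map sending \<open>x\<close> to
  \<open>(x, c)\<close>.\<close>

lemma mt_homotopicD:
  assumes X: "mt_space X" and fg: "mt_homotopic X Y f g"
  shows "mt_map X Y f" "mt_map X Y g"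
proof -
  obtain H where H: "mt_map (mt_prod X (mt_borel (top_of_set {0..1::real}))) Y H"
    and ends: "\<And>x. x \<in> topspace (mt_top X) \<Longrightarrow> H (x, 0) = f x \<and> H (x, 1) = g x"
    using fg by (auto simp: mt_homotopic_def)
  have H1: "H \<in> mt_sigma X \<Otimes>\<^sub>M borel_of (top_of_set {0..1}) \<rightarrow>\<^sub>M mt_sigma Y"
    and H2: "continuous_map (prod_topology (mt_top X) (top_of_set {0..1})) (mt_top Y) H"
    using H by (auto simp: mt_map_def mt_prod_def mt_borel_def)
  have *: "mt_map X Y u" if c: "c \<in> {0..1}" and u: "\<And>x. x \<in> topspace (mt_top X) \<Longrightarrow> H (x, c) = u x" for c u
  proof -
    have "(\<lambda>x. (x, c)) \<in> mt_sigma X \<rightarrow>\<^sub>M mt_sigma X \<Otimes>\<^sub>M borel_of (top_of_set {0..1})"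
      using c by (intro measurable_Pair measurable_const) auto
    \<comment> \<open>The ends agree with \<open>H\<close> on \<open>topspace\<close>;
      \<open>mt_space X\<close> makes this the space of \<open>mt_sigma X\<close>.\<close>
    from measurable_compose[OF this H1] have 1: "u \<in> mt_sigma X \<rightarrow>\<^sub>M mt_sigma Y"
      by (rule measurable_cong[THEN iffD1, rotated]) (use u X in \<open>simp add: mt_space_def\<close>)
    have "continuous_map (mt_top X) (prod_topology (mt_top X) (top_of_set {0..1})) (\<lambda>x. (x, c))"
      using c by (intro continuous_map_pairedI) auto
    from continuous_map_compose[OF this H2] have "continuous_map (mt_top X) (mt_top Y) u"
      by (rule continuous_map_eq) (simp add: u)
    with 1 show ?thesis by (simp add: mt_map_def)
  qed
  show "mt_map X Y f" "mt_map X Y g"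
    using *[of 0 f] *[of 1 g] ends by auto
qed

text \<open>On a cocycle the prism operator applied to the coboundary vanishes, so the homotopy
  formula leaves a coboundary as the difference.\<close>

lemma cochain_pullback_homotopic:
  assumes \<Gamma>: "standard_group \<Gamma> \<or> standard_ring \<Gamma>" and fg: "mt_homotopic X Y f g"
    and \<omega>: "\<omega> \<in> mt_cocycles n Y \<Gamma>"
  obtains b where "b \<in> mt_coboundaries n X \<Gamma>"
    "cochain_pullback n (mt_top X) f \<omega> =
       b \<otimes>\<^bsub>cochain_group n (mt_top X) \<Gamma>\<^esub> cochain_pullback n (mt_top X) g \<omega>"
proof -
  note G = standard_group_or_ringD[OF \<Gamma>]
  interpret abelian_group \<Gamma> by (rule G)
  obtain H where H: "mt_map (mt_prod X (mt_borel (top_of_set {0..1::real}))) Y H"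
    and ends: "\<And>x. x \<in> topspace (mt_top X) \<Longrightarrow> H (x, 0) = f x"
      "\<And>x. x \<in> topspace (mt_top X) \<Longrightarrow> H (x, 1) = g x"
    using fg by (auto simp: mt_homotopic_def)
  have H2: "continuous_map (prod_topology (mt_top X) (top_of_set {0..1})) (mt_top Y) H"
    using H by (simp add: mt_map_def mt_prod_def mt_borel_def)
  have \<omega>c: "\<omega> \<in> carrier (mt_cochain_group n Y \<Gamma>)"
    and d\<omega>: "coboundary n (mt_top Y) \<Gamma> \<omega> = (\<lambda>\<sigma>\<in>singular_simplex_set (Suc n) (mt_top Y). \<zero>\<^bsub>\<Gamma>\<^esub>)"
    using \<omega> by (auto simp: mt_cocycles_def kernel_def mt_cochain_group_simps)
  then have \<omega>c': "\<omega> \<in> carrier (cochain_group n (mt_top Y) \<Gamma>)"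
    by (simp add: mt_cochain_group_simps cochain_group_simps)
  \<comment> \<open>In degree 0 the only coboundary is the neutral cochain.\<close>
  define b where "b = (case n of 0 \<Rightarrow> \<one>\<^bsub>mt_cochain_group 0 X \<Gamma>\<^esub>
    | Suc m \<Rightarrow> coboundary m (mt_top X) \<Gamma> (prism_cochain m (mt_top X) \<Gamma> H \<omega>))"
  have b: "b \<in> mt_coboundaries n X \<Gamma>"
    using prism_cochain_mt_cochain[OF \<Gamma> H] \<omega>c
    by (auto simp: b_def mt_coboundaries_def split: nat.split)
  have "\<omega> (simplex_map n f \<sigma>) = b \<sigma> \<oplus>\<^bsub>\<Gamma>\<^esub> \<omega> (simplex_map n g \<sigma>)"
    if \<sigma>: "singular_simplex n (mt_top X) \<sigma>" for \<sigma>
  proof -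
    have maps: "simplex_map n (\<lambda>x. H (x, 0)) \<sigma> = simplex_map n f \<sigma>"
      "simplex_map n (\<lambda>x. H (x, 1)) \<sigma> = simplex_map n g \<sigma>"
      by (rule simplex_map_eq[OF \<sigma>]; simp add: ends)+
    have "prism_cochain n (mt_top X) \<Gamma> H (coboundary n (mt_top Y) \<Gamma> \<omega>) \<sigma> = \<zero>\<^bsub>\<Gamma>\<^esub>"
      using \<sigma> singular_simplex_prism_simplex[OF H2 \<sigma>]
      by (auto simp: prism_cochain_def d\<omega> intro!: add.finprod_one_eqI)
    moreover have "(case n of 0 \<Rightarrow> \<zero>\<^bsub>\<Gamma>\<^esub>
        | Suc m \<Rightarrow> coboundary m (mt_top X) \<Gamma> (prism_cochain m (mt_top X) \<Gamma> H \<omega>) \<sigma>) = b \<sigma>"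
      using \<sigma> by (auto simp: b_def mt_cochain_group_simps split: nat.split)
    moreover have "b \<sigma> \<in> carrier \<Gamma>"
      using subgroup.mem_carrier[OF subgroup_mt_coboundaries[OF \<Gamma>] b] \<sigma>
      by (auto simp: cochain_group_simps)
    ultimately show ?thesis
      using prism_cochain_homotopy[OF G(1) H2 \<omega>c' \<sigma>] by (simp add: maps)
  qed
  then have "cochain_pullback n (mt_top X) f \<omega> =
      b \<otimes>\<^bsub>cochain_group n (mt_top X) \<Gamma>\<^esub> cochain_pullback n (mt_top X) g \<omega>"
    by (auto simp: cochain_pullback_def cochain_group_simps fun_eq_iff)
  with b that show ?thesis by blast
qed

theorem proposition2p3:
  fixes X :: "'a mt_struct" and Y :: "'b mt_struct" and \<Gamma> :: "'g sigma_ring"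
    and f g :: "'a \<Rightarrow> 'b"
  assumes "mt_space X" and "mt_space Y"
    and "standard_group \<Gamma> \<or> standard_ring \<Gamma>"
    and "mt_homotopic X Y f g"
  shows "\<forall>n. mt_cohomology_map n X Y \<Gamma> f = mt_cohomology_map n X Y \<Gamma> g"
proof
  fix n
  note \<Gamma> = assms(3)
  note f = mt_homotopicD(1)[OF assms(1,4)] and g = mt_homotopicD(2)[OF assms(1,4)]
  let ?C = "cochain_group n (mt_top X) \<Gamma>" and ?B = "mt_coboundaries n X \<Gamma>"
  interpret C: group ?C by (rule group_cochain_group[OF standard_group_or_ringD(1)[OF \<Gamma>]])
  interpret B: subgroup ?B ?C by (rule subgroup_mt_coboundaries[OF \<Gamma>])
  have "mt_cohomology_map n X Y \<Gamma> f c = mt_cohomology_map n X Y \<Gamma> g c"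
    if "c \<in> carrier (mt_cohomology n Y \<Gamma>)" for c
  proof -
    obtain \<omega> where \<omega>: "\<omega> \<in> mt_cocycles n Y \<Gamma>"
      and c: "c = mt_coboundaries n Y \<Gamma> #>\<^bsub>mt_cochain_group n Y \<Gamma>\<^esub> \<omega>"
      using \<open>c \<in> _\<close> by (auto simp: mt_cohomology_def carrier_FactGroup r_coset_def)
    obtain b where b: "b \<in> ?B" "cochain_pullback n (mt_top X) f \<omega> = b \<otimes>\<^bsub>?C\<^esub> cochain_pullback n (mt_top X) g \<omega>"
      using cochain_pullback_homotopic[OF \<Gamma> assms(4) \<omega>] .
    have "cochain_pullback n (mt_top X) g \<omega> \<in> carrier ?C"
      using cochain_pullback_mt_cochain[OF g, of \<omega> n \<Gamma>] \<omega>
      by (simp add: mt_cocycles_def kernel_def mt_cochain_group_simps cochain_group_simps)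
    \<comment> \<open>Multiplying a representative on the left by an element of \<open>?B\<close>
      keeps its right coset.\<close>
    then have "?B #>\<^bsub>?C\<^esub> cochain_pullback n (mt_top X) f \<omega> = ?B #>\<^bsub>?C\<^esub> cochain_pullback n (mt_top X) g \<omega>"
      using b C.coset_mult_assoc[OF B.subset] C.coset_join2[OF _ B.subgroup_axioms] by (metis B.mem_carrier)
    then show ?thesis
      unfolding c mt_cohomology_map_class[OF \<Gamma> f \<omega>] mt_cohomology_map_class[OF \<Gamma> g \<omega>]
      by (simp add: r_coset_def mt_cochain_group_def)
  qed
  \<comment> \<open>Both maps are extensional, so agreement on all classes makes them equal.\<close>
  then show "mt_cohomology_map n X Y \<Gamma> f = mt_cohomology_map n X Y \<Gamma> g"
    unfolding mt_cohomology_map_def by (intro restrict_ext) (auto simp: fun_eq_iff)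
qed

end
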